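(* Let $\Omega\subset\mathbb{R}^n$ be a bounded Lipschitz domain. Then there exist an open set $\Omega'$ with $\Omega\Subset\Omega'$ and a bounded linear extension operator $\mathscr{E}_{\mathrm{L}^1}\colon \mathrm{L}^1(\Omega;\mathbb{R}^n)\to\mathrm{L}^1(\Omega';\mathbb{R}^n)$ (that is, $(\mathscr{E}_{\mathrm{L}^1}u)|_{\Omega}=u$ $\mathscr{L}^n$-a.e. for every $u\in\mathrm{L}^1(\Omega;\mathbb{R}^n)$) such that $u\in\mathrm{L}^1_{\operatorname{div}}(\Omega)$ implies $\mathscr{E}_{\mathrm{L}^1}u\in\mathrm{L}^1_{\operatorname{div}}(\Omega')$.
   Context: A Lipschitz domain is an open, bounded, connected set whose boundary is locally the graph of a Lipschitz function. For an open set $U\subset\mathbb{R}^n$, $\mathrm{L}^1_{\operatorname{div}}(U)=\{u\in\mathrm{L}^1(U;\mathbb{R}^n)\colon \operatorname{div}u=0 \text{ in } \mathscr{D}'(U)\}$, i.e. $\int_U u\cdot\nabla\varphi\,dx=0$ for all $\varphi\in C^\infty_c(U)$. *)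

theory Defs
  imports "HOL-Analysis.Analysis"
begin

text \<open>Lipschitz domain: open, bounded, connected, and near every boundary point the set is,
  in suitable orthonormal coordinates (unit vector e = "vertical" direction, its orthogonal
  complement = the hyperplane of the remaining n-1 coordinates), the region strictly below
  the graph of a Lipschitz function, inside an open cylinder.\<close>
definition lipschitz_domain :: "'a::euclidean_space set \<Rightarrow> bool" where
  "lipschitz_domain \<Omega> \<longleftrightarrow> open \<Omega> \<and> bounded \<Omega> \<and> connected \<Omega> \<and>
     (\<forall>x\<in>frontier \<Omega>. \<exists>e r h L g. norm e = 1 \<and> r > 0 \<and> h > 0 \<and>
        L-lipschitz_on {y. y \<bullet> e = 0} (g :: 'a \<Rightarrow> real) \<and>
        (\<forall>y. norm ((y - x) - ((y - x) \<bullet> e) *\<^sub>R e) < r \<and> \<bar>(y - x) \<bullet> e\<bar> < h \<longrightarrow>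
             (y \<in> \<Omega> \<longleftrightarrow> (y - x) \<bullet> e < g ((y - x) - ((y - x) \<bullet> e) *\<^sub>R e))))"

fun Ck_fun :: "nat \<Rightarrow> ('a::euclidean_space \<Rightarrow> real) \<Rightarrow> bool" where
  "Ck_fun 0 f = continuous_on UNIV f"
| "Ck_fun (Suc k) f = (f differentiable_on UNIV \<and>
      (\<forall>v. Ck_fun k (\<lambda>x. frechet_derivative f (at x) v)))"

definition smooth_fun :: "('a::euclidean_space \<Rightarrow> real) \<Rightarrow> bool" where
  "smooth_fun f \<longleftrightarrow> (\<forall>k. Ck_fun k f)"

definition test_fun :: "'a::euclidean_space set \<Rightarrow> ('a \<Rightarrow> real) \<Rightarrow> bool" where
  "test_fun U \<phi> \<longleftrightarrow> smooth_fun \<phi> \<and>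
     (\<exists>K. compact K \<and> K \<subseteq> U \<and> (\<forall>x. x \<notin> K \<longrightarrow> \<phi> x = 0))"

definition L1 :: "'a::euclidean_space set \<Rightarrow> ('a \<Rightarrow> 'a) \<Rightarrow> bool" where
  "L1 U u \<longleftrightarrow> set_integrable lebesgue U u"

definition L1_norm :: "'a::euclidean_space set \<Rightarrow> ('a \<Rightarrow> 'a) \<Rightarrow> real" where
  "L1_norm U u = (LINT x:U|lebesgue. norm (u x))"

text \<open>L^1_div(U): integrable with distributional divergence zero:
  integral of u \<bullet> grad phi vanishes for all test functions phi.\<close>
definition L1_div :: "'a::euclidean_space set \<Rightarrow> ('a \<Rightarrow> 'a) \<Rightarrow> bool" where
  "L1_div U u \<longleftrightarrow> L1 U u \<and>
     (\<forall>\<phi>. test_fun U \<phi> \<longrightarrow> (LINT x:U|lebesgue. frechet_derivative \<phi> (at x) (u x)) = 0)"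

end

theory Submission
  imports Defs
begin

text \<open>
  The extension is the dual of an extension operator for test functions.
  Near each boundary point the domain has a direction \<open>e z\<close> in which one leaves it at a controlled
  rate. With a smooth partition of unity into such charts and dyadic layers at distance \<open>2 ^ -k\<close> from
  the boundary, a test function \<open>\<phi>\<close> on the larger set is reflected to
  \<open>S \<phi> x = (\<Sum>z k. p z k x * \<phi> (x + h k *\<^sub>R e z))\<close>, where \<open>h k \<sim> 2 ^ -k\<close> is so large that all
  shifted points lie outside \<open>\<Omega>\<close>. Then \<open>\<phi> - S \<phi>\<close> has boundary values zero and a bounded gradient, so
  it may be tested against a divergence free field on \<open>\<Omega>\<close>. Moreover \<open>\<nabla>(S \<phi>)\<close> depends boundedly on
  the values of \<open>\<nabla>\<phi>\<close> outside \<open>\<Omega>\<close> only, because each increment of \<open>\<phi>\<close> between consecutive shifts is a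
  line integral of \<open>\<nabla>\<phi>\<close> of length comparable to the layer width. Hence \<open>u\<close> minus the adjoint of
  \<open>\<nabla>\<phi> \<mapsto> \<nabla>(S \<phi>)\<close> applied to \<open>u\<close> is bounded on \<open>L1\<close>, equals \<open>u\<close> on \<open>\<Omega>\<close>, and is divergence free
  whenever \<open>u\<close> is.
  Only translations occur, so neither Rademacher's theorem nor a change of variables is needed.
\<close>

text \<open>The obstacle is that the weights \<open>p z k\<close> have gradients of order 2 ^ k,
  while the values of \<phi> multiplying them are not small. Summation by parts over k cures this,
  since the weights of one chart are consecutive differences, but it leaves two boundary terms. At
  the innermost layer \<phi> occurs at the full shift \<open>H\<close> without a partner;
  \<open>\<Omega>'\<close> is therefore taken so thin that this shift leaves
  \<open>\<Omega>'\<close>, where \<phi> vanishes. At the outermost layer of a truncated sum the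
  remainder is paired with the derivative of the cutoff that multiplies \<phi> itself, because the
  charts sum to 1 near the boundary. The truncated functions are genuine test functions on \<Omega>
  with gradients bounded uniformly in the truncation, so the limit is a dominated convergence. A
  field in L1 is only Lebesgue measurable and known almost everywhere. It is first replaced by a
  Borel representative that vanishes off \<Omega>, and linearity is obtained almost
  everywhere.\<close>

subsection \<open>Smooth functions and cutoffs\<close>

text \<open>\<open>frechet_derivative\<close> is a choice operator. Uniqueness of the derivative
  allows any explicit candidate \<open>f'\<close> in its place, so the inductions below can use the
  usual differentiation formulas.\<close>

lemma Ck_fun_Suc_iff:
  "Ck_fun (Suc k) f \<longleftrightarrow>
    (\<exists>f'. (\<forall>x. (f has_derivative f' x) (at x)) \<and> (\<forall>v. Ck_fun k (\<lambda>x. f' x v)))"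
proof
  assume "Ck_fun (Suc k) f"
  then have "f differentiable_on UNIV" and D: "\<forall>v. Ck_fun k (\<lambda>x. frechet_derivative f (at x) v)"
    by auto
  then have "\<forall>x. (f has_derivative frechet_derivative f (at x)) (at x)"
    by (simp add: differentiable_on_def frechet_derivative_works)
  with D show "\<exists>f'. (\<forall>x. (f has_derivative f' x) (at x)) \<and> (\<forall>v. Ck_fun k (\<lambda>x. f' x v))"
    by (intro exI[where x = "\<lambda>x. frechet_derivative f (at x)"] conjI)
next
  assume "\<exists>f'. (\<forall>x. (f has_derivative f' x) (at x)) \<and> (\<forall>v. Ck_fun k (\<lambda>x. f' x v))"
  then obtain f' where f': "\<And>x. (f has_derivative f' x) (at x)" "\<And>v. Ck_fun k (\<lambda>x. f' x v)"
    by blast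
  then have "frechet_derivative f (at x) = f' x" for x
    using frechet_derivative_at by metis
  with f' show "Ck_fun (Suc k) f"
    by (auto simp: differentiable_on_def differentiable_def)
qed

lemma Ck_fun_SucI:
  assumes "\<And>x. (f has_derivative f' x) (at x)" and "\<And>v. Ck_fun k (\<lambda>x. f' x v)"
  shows "Ck_fun (Suc k) f"
  unfolding Ck_fun_Suc_iff using assms by blast

lemma Ck_fun_SucE:
  assumes "Ck_fun (Suc k) f"
  obtains f' where "\<And>x. (f has_derivative f' x) (at x)" and "\<And>v. Ck_fun k (\<lambda>x. f' x v)"
  using assms unfolding Ck_fun_Suc_iff by blast

text \<open>Product and quotient rules leave the original functions undifferentiated; the inductions
  need these, given at order \<open>Suc k\<close>, also at order \<open>k\<close>.\<close>

lemma Ck_fun_SucD: "Ck_fun (Suc k) f \<Longrightarrow> Ck_fun k f"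
proof (induction k arbitrary: f)
  case 0
  then show ?case by (auto intro: differentiable_imp_continuous_on)
next
  case (Suc k)
  obtain f' where f': "\<And>x. (f has_derivative f' x) (at x)" "\<And>v. Ck_fun (Suc k) (\<lambda>x. f' x v)"
    using Suc.prems by (elim Ck_fun_SucE) (rule that; assumption)
  show ?case by (rule Ck_fun_SucI[OF f'(1) Suc.IH[OF f'(2)]])
qed

lemma Ck_fun_const: "Ck_fun k (\<lambda>x. c)"
proof (induction k arbitrary: c)
  case (Suc k)
  show ?case by (rule Ck_fun_SucI[where f' = "\<lambda>_ _. 0"]) (auto simp: Suc)
qed simp

lemma Ck_fun_add: "Ck_fun k f \<Longrightarrow> Ck_fun k g \<Longrightarrow> Ck_fun k (\<lambda>x. f x + g x)"
proof (induction k arbitrary: f g)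
  case 0
  then show ?case by (simp add: continuous_on_add)
next
  case (Suc k)
  obtain f' where f': "\<And>x. (f has_derivative f' x) (at x)" "\<And>v. Ck_fun k (\<lambda>x. f' x v)"
    using Suc.prems(1) by (elim Ck_fun_SucE) (rule that; assumption)
  obtain g' where g': "\<And>x. (g has_derivative g' x) (at x)" "\<And>v. Ck_fun k (\<lambda>x. g' x v)"
    using Suc.prems(2) by (elim Ck_fun_SucE) (rule that; assumption)
  show ?case
    by (rule Ck_fun_SucI[where f' = "\<lambda>x v. f' x v + g' x v"])
       (use f' g' Suc.IH in \<open>auto intro: has_derivative_add\<close>)
qed

lemma Ck_fun_mult: "Ck_fun k f \<Longrightarrow> Ck_fun k g \<Longrightarrow> Ck_fun k (\<lambda>x. f x * g x)"
proof (induction k arbitrary: f g)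
  case 0
  then show ?case by (simp add: continuous_on_mult)
next
  case (Suc k)
  obtain f' where f': "\<And>x. (f has_derivative f' x) (at x)" "\<And>v. Ck_fun k (\<lambda>x. f' x v)"
    using Suc.prems(1) by (elim Ck_fun_SucE) (rule that; assumption)
  obtain g' where g': "\<And>x. (g has_derivative g' x) (at x)" "\<And>v. Ck_fun k (\<lambda>x. g' x v)"
    using Suc.prems(2) by (elim Ck_fun_SucE) (rule that; assumption)
  show ?case
    by (rule Ck_fun_SucI[where f' = "\<lambda>x v. f x * g' x v + f' x v * g x"])
       (auto intro!: has_derivative_mult Ck_fun_add Suc.IH f' g' Suc.prems[THEN Ck_fun_SucD])
qed

lemma Ck_fun_inverse: "Ck_fun k f \<Longrightarrow> (\<And>x. f x \<noteq> 0) \<Longrightarrow> Ck_fun k (\<lambda>x. inverse (f x))"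
proof (induction k arbitrary: f)
  case 0
  then show ?case by (simp add: continuous_on_inverse)
next
  case (Suc k)
  obtain f' where f': "\<And>x. (f has_derivative f' x) (at x)" "\<And>v. Ck_fun k (\<lambda>x. f' x v)"
    using Suc.prems(1) by (elim Ck_fun_SucE) (rule that; assumption)
  have inv: "Ck_fun k (\<lambda>x. inverse (f x))"
    using Suc Ck_fun_SucD by blast
  show ?case
  proof (rule Ck_fun_SucI)
    show "((\<lambda>x. inverse (f x)) has_derivative (\<lambda>v. - 1 * (inverse (f x) * f' x v * inverse (f x)))) (at x)" for x
      using Deriv.has_derivative_inverse[OF Suc.prems(2) f'(1)] by simp
    show "Ck_fun k (\<lambda>x. - 1 * (inverse (f x) * f' x v * inverse (f x)))" for v
      by (intro Ck_fun_mult Ck_fun_const inv f')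
  qed
qed

text \<open>The inner map has constant derivative, so each directional derivative is
  \<open>f'\<close> in the fixed direction \<open>v \<bullet> w\<close>, composed with the same
  affine map. This closes the induction.\<close>

lemma Ck_fun_affine:
  fixes f :: "real \<Rightarrow> real" and w :: "'a::euclidean_space"
  shows "Ck_fun k f \<Longrightarrow> Ck_fun k (\<lambda>x. f (x \<bullet> w + c))"
proof (induction k arbitrary: f)
  case 0
  have "continuous_on UNIV (f \<circ> (\<lambda>x. x \<bullet> w + c))"
    by (rule continuous_on_compose)
       (use 0 in \<open>auto intro!: continuous_intros intro: continuous_on_subset\<close>)
  then show ?case by (simp add: o_def)
next
  case (Suc k)
  obtain f' where f': "\<And>x. (f has_derivative f' x) (at x)" "\<And>v. Ck_fun k (\<lambda>x. f' x v)"
    using Suc.prems(1) by (elim Ck_fun_SucE) (rule that; assumption)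
  show ?case
  proof (rule Ck_fun_SucI)
    show "((\<lambda>x. f (x \<bullet> w + c)) has_derivative (\<lambda>v. f' (x \<bullet> w + c) (v \<bullet> w))) (at x)" for x
      by (rule has_derivative_compose[OF _ f'(1)]) (auto intro!: derivative_eq_intros)
    show "Ck_fun k (\<lambda>x. f' (x \<bullet> w + c) (v \<bullet> w))" for v
      by (rule Suc.IH[OF f'(2)])
  qed
qed

lemma Ck_fun_shift: "Ck_fun k f \<Longrightarrow> Ck_fun k (\<lambda>x. f (x + c))"
proof (induction k arbitrary: f)
  case 0
  have "continuous_on UNIV (f \<circ> (\<lambda>x. x + c))"
    by (rule continuous_on_compose)
       (use 0 in \<open>auto intro!: continuous_intros intro: continuous_on_subset\<close>)
  then show ?case by (simp add: o_def)
next
  case (Suc k)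
  obtain f' where f': "\<And>x. (f has_derivative f' x) (at x)" "\<And>v. Ck_fun k (\<lambda>x. f' x v)"
    using Suc.prems(1) by (elim Ck_fun_SucE) (rule that; assumption)
  show ?case
  proof (rule Ck_fun_SucI)
    show "((\<lambda>x. f (x + c)) has_derivative (\<lambda>v. f' (x + c) v)) (at x)" for x
      by (rule has_derivative_compose[OF _ f'(1)]) (auto intro!: derivative_eq_intros)
    show "Ck_fun k (\<lambda>x. f' (x + c) v)" for v
      by (rule Suc.IH[OF f'(2)])
  qed
qed

named_theorems smooth_intros

lemma smooth_const [smooth_intros]: "smooth_fun (\<lambda>x. c)"
  by (simp add: smooth_fun_def Ck_fun_const)

lemma smooth_add [smooth_intros]: "smooth_fun f \<Longrightarrow> smooth_fun g \<Longrightarrow> smooth_fun (\<lambda>x. f x + g x)"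
  by (simp add: smooth_fun_def Ck_fun_add)

lemma smooth_mult [smooth_intros]: "smooth_fun f \<Longrightarrow> smooth_fun g \<Longrightarrow> smooth_fun (\<lambda>x. f x * g x)"
  by (simp add: smooth_fun_def Ck_fun_mult)

lemma smooth_inverse: "smooth_fun f \<Longrightarrow> (\<And>x. f x \<noteq> 0) \<Longrightarrow> smooth_fun (\<lambda>x. inverse (f x))"
  by (simp add: smooth_fun_def Ck_fun_inverse)

lemma smooth_affine: "smooth_fun f \<Longrightarrow> smooth_fun (\<lambda>x. f (x \<bullet> w + c))"
  by (simp add: smooth_fun_def Ck_fun_affine)

lemma smooth_shift [smooth_intros]: "smooth_fun f \<Longrightarrow> smooth_fun (\<lambda>x. f (x + c))"
  by (simp add: smooth_fun_def Ck_fun_shift)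

lemma smooth_diff [smooth_intros]:
  assumes "smooth_fun f" "smooth_fun g" shows "smooth_fun (\<lambda>x. f x - g x)"
proof -
  have "smooth_fun (\<lambda>x. f x + (- 1) * g x)"
    by (intro smooth_intros assms)
  then show ?thesis by simp
qed

lemma smooth_sum [smooth_intros]:
  "(\<And>i. i \<in> I \<Longrightarrow> smooth_fun (f i)) \<Longrightarrow> smooth_fun (\<lambda>x. \<Sum>i\<in>I. f i x)"
  by (induction I rule: infinite_finite_induct) (auto intro: smooth_intros)

lemma smooth_prod [smooth_intros]:
  "(\<And>i. i \<in> I \<Longrightarrow> smooth_fun (f i)) \<Longrightarrow> smooth_fun (\<lambda>x. \<Prod>i\<in>I. f i x)"
  by (induction I rule: infinite_finite_induct) (auto intro: smooth_intros)

section \<open>Gradients of smooth functions\<close>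

definition grad :: "('a::euclidean_space \<Rightarrow> real) \<Rightarrow> 'a \<Rightarrow> 'a" where
  "grad f x = (\<Sum>b\<in>Basis. frechet_derivative f (at x) b *\<^sub>R b)"

lemma inner_grad:
  assumes "f differentiable at x"
  shows "grad f x \<bullet> v = frechet_derivative f (at x) v"
proof -
  have lin: "linear (frechet_derivative f (at x))"
    using assms frechet_derivative_works has_derivative_linear by blast
  have "frechet_derivative f (at x) v = frechet_derivative f (at x) (\<Sum>b\<in>Basis. (v \<bullet> b) *\<^sub>R b)"
    by (simp add: euclidean_representation)
  also have "\<dots> = (\<Sum>b\<in>Basis. (v \<bullet> b) * frechet_derivative f (at x) b)"
    by (simp add: linear_sum[OF lin] linear_cmul[OF lin])
  also have "\<dots> = grad f x \<bullet> v"
    unfolding grad_def inner_sum_left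
    by (intro sum.cong) (simp_all add: inner_commute)
  finally show ?thesis by simp
qed

lemma grad_eqI:
  assumes "(f has_derivative (\<lambda>v. g \<bullet> v)) (at x)"
  shows "grad f x = g"
proof -
  have "frechet_derivative f (at x) = (\<lambda>v. g \<bullet> v)"
    using frechet_derivative_at[OF assms] by simp
  then have "grad f x \<bullet> v = g \<bullet> v" for v
    using inner_grad[of f x v] assms by (auto simp: differentiable_def)
  then show ?thesis
    using vector_eq_rdot[of "grad f x" g] by blast
qed

lemma smooth_differentiable: "smooth_fun f \<Longrightarrow> f differentiable at x"
proof -
  assume "smooth_fun f"
  then have "Ck_fun (Suc 0) f" unfolding smooth_fun_def by blast
  then show ?thesis by (simp add: differentiable_on_def)
qed

lemma smooth_inner_grad: "smooth_fun f \<Longrightarrow> frechet_derivative f (at x) v = grad f x \<bullet> v"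
  by (simp add: inner_grad smooth_differentiable)

lemma smooth_has_derivative: "smooth_fun f \<Longrightarrow> (f has_derivative (\<lambda>v. grad f x \<bullet> v)) (at x)"
proof -
  assume f: "smooth_fun f"
  then have "(f has_derivative frechet_derivative f (at x)) (at x)"
    using frechet_derivative_works smooth_differentiable by blast
  then show ?thesis using f by (simp add: smooth_inner_grad[symmetric])
qed

lemma smooth_continuous: "smooth_fun f \<Longrightarrow> continuous_on S f"
  by (meson differentiable_imp_continuous_within continuous_at_imp_continuous_on smooth_differentiable)

lemma smooth_continuous_grad: "smooth_fun f \<Longrightarrow> continuous_on S (grad f)"
proof -
  assume "smooth_fun f"
  then have "Ck_fun (Suc 0) f" unfolding smooth_fun_def by blast
  then have "continuous_on UNIV (\<lambda>x. frechet_derivative f (at x) v)" for v by simp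
  then have "continuous_on S (\<lambda>x. frechet_derivative f (at x) v)" for v
    using continuous_on_subset by blast
  then show ?thesis
    unfolding grad_def[abs_def] by (intro continuous_intros)
qed

lemma grad_diff: "smooth_fun f \<Longrightarrow> smooth_fun g \<Longrightarrow> grad (\<lambda>x. f x - g x) x = grad f x - grad g x"
  by (intro grad_eqI)
     (auto intro!: derivative_eq_intros smooth_has_derivative simp: inner_diff_left)

lemma grad_const: "grad (\<lambda>x. c) x = 0"
  by (intro grad_eqI) auto

lemma grad_sum:
  "(\<And>i. i \<in> I \<Longrightarrow> smooth_fun (f i)) \<Longrightarrow> grad (\<lambda>x. \<Sum>i\<in>I. f i x) x = (\<Sum>i\<in>I. grad (f i) x)"
  by (intro grad_eqI)
     (auto intro!: has_derivative_sum smooth_has_derivative simp: inner_sum_left)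

lemma grad_mult:
  "smooth_fun f \<Longrightarrow> smooth_fun g \<Longrightarrow> grad (\<lambda>x. f x * g x) x = g x *\<^sub>R grad f x + f x *\<^sub>R grad g x"
  by (intro grad_eqI)
     (auto intro!: derivative_eq_intros smooth_has_derivative simp: inner_add_left algebra_simps)

lemma grad_shift: "smooth_fun f \<Longrightarrow> grad (\<lambda>x. f (x + c)) x = grad f (x + c)"
  by (intro grad_eqI has_derivative_compose[OF _ smooth_has_derivative, where f = "\<lambda>x. x + c"])
     (auto intro!: derivative_eq_intros)

text \<open>Cutoffs take values in [0, 1], so their gradients vanish wherever a value 0 or 1 is
  attained. Applied to \<open>f\<close> or to \<open>1 - f\<close>, this localizes gradients
  pointwise, even at the edge of a support.\<close>

lemma grad_local_min:
  assumes "smooth_fun f" "\<And>y. f x \<le> f y"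
  shows "grad f x = 0"
proof -
  have "(\<lambda>v. grad f x \<bullet> v) = (\<lambda>v. 0)"
    by (rule differential_zero_maxmin[of x UNIV f])
       (use assms smooth_has_derivative in auto)
  then have "grad f x \<bullet> grad f x = 0" by metis
  then show ?thesis by simp
qed

lemma grad_eq_on_open:
  assumes "open S" "x \<in> S" "\<And>y. y \<in> S \<Longrightarrow> f y = g y" "smooth_fun g"
  shows "grad f x = grad g x"
  by (intro grad_eqI has_derivative_transform_within_open[OF smooth_has_derivative[of g x], of S])
     (use assms in auto)

lemma smooth_compact_support_grad_bounded:
  assumes "smooth_fun f" "compact K" "\<And>x. x \<notin> K \<Longrightarrow> f x = 0"
  obtains B where "B > 0" "\<And>x. norm (grad f x) \<le> B" "\<And>x. x \<notin> K \<Longrightarrow> grad f x = 0"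
proof -
  have z: "grad f x = 0" if "x \<notin> K" for x
    using grad_eq_on_open[of "- K" x f "\<lambda>_. 0"] assms that
    by (auto simp: compact_imp_closed open_Compl smooth_const grad_const)
  have "bounded (grad f ` K)"
    using assms by (simp add: compact_continuous_image compact_imp_bounded smooth_continuous_grad)
  then obtain B where "B > 0" "\<forall>x\<in>K. norm (grad f x) \<le> B"
    by (auto simp: bounded_pos)
  with z that show thesis
    by (metis less_eq_real_def norm_zero)
qed

lemma smooth_lipschitz:
  assumes "smooth_fun f" "\<And>x. norm (grad f x) \<le> B"
  shows "\<bar>f x - f y\<bar> \<le> B * norm (x - y)"
proof -
  have "norm (f x - f y) \<le> B * norm (x - y)"
  proof (rule differentiable_bound[of UNIV])
    show "(f has_derivative (\<lambda>v. grad f x \<bullet> v)) (at x within UNIV)" for x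
      using assms smooth_has_derivative by blast
    show "onorm (\<lambda>v. grad f x \<bullet> v) \<le> B" for x
    proof (rule onorm_le)
      fix v
      have "norm (grad f x \<bullet> v) \<le> norm (grad f x) * norm v"
        by (simp add: Cauchy_Schwarz_ineq2)
      also have "\<dots> \<le> B * norm v"
        by (intro mult_right_mono assms) auto
      finally show "norm (grad f x \<bullet> v) \<le> B * norm v" .
    qed
  qed auto
  then show ?thesis by simp
qed

section \<open>Smooth steps and cutoffs with quantitative gradient bounds\<close>

definition exp_flat :: "nat \<Rightarrow> real \<Rightarrow> real" where
  "exp_flat m t = (if t \<le> 0 then 0 else exp (- 1 / t) / t ^ m)"

lemma exp_flat_tendsto_0: "(exp_flat m \<longlongrightarrow> 0) (at 0)"
proof -
  have "((\<lambda>x::real. x ^ m / exp x) \<longlongrightarrow> 0) at_top"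
    by (rule tendsto_power_div_exp_0)
  \<comment> \<open>The substitution x = 1/t reduces the decay at 0 from the right to the
    exponential beating powers.\<close>
  then have "((\<lambda>t::real. (inverse t) ^ m / exp (inverse t)) \<longlongrightarrow> 0) (at_right 0)"
    by (rule filterlim_compose[OF _ filterlim_inverse_at_top_right])
  moreover have "eventually (\<lambda>t. (inverse t) ^ m / exp (inverse t) = exp_flat m t) (at_right 0)"
    by (auto simp: eventually_at_filter exp_flat_def exp_minus field_simps)
  ultimately have "(exp_flat m \<longlongrightarrow> 0) (at_right 0)"
    by (rule Lim_transform_eventually)
  moreover have "(exp_flat m \<longlongrightarrow> 0) (at_left 0)"
    by (rule tendsto_eventually) (auto simp: exp_flat_def eventually_at_filter)
  ultimately show ?thesis by (simp add: filterlim_split_at)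
qed

text \<open>The family is closed under differentiation up to linear combinations. Treating all
  exponents \<open>m\<close> at once makes \<open>smooth_exp_flat\<close> a single
  induction.\<close>

lemma exp_flat_has_derivative:
  "(exp_flat m has_real_derivative (exp_flat (m + 2) t - real m * exp_flat (m + 1) t)) (at t)"
proof -
  consider "t < 0" | "t = 0" | "t > 0" by linarith
  then show ?thesis
  proof cases
    case 1
    have "((\<lambda>_. 0) has_real_derivative 0) (at t)" by simp
    then have "(exp_flat m has_real_derivative 0) (at t)"
      by (rule has_field_derivative_transform_within_open[where S = "{..<0}"])
         (use 1 in \<open>auto simp: exp_flat_def\<close>)
    with 1 show ?thesis by (simp add: exp_flat_def)
  next
    case 2
    \<comment> \<open>At 0 the difference quotient of \<open>exp_flat m\<close> is
      \<open>exp_flat (m + 1)\<close>, whose limit is already known.\<close>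
    have "((\<lambda>t. (exp_flat m t - exp_flat m 0) / (t - 0)) \<longlongrightarrow> 0) (at 0)"
      by (rule Lim_transform_eventually[OF exp_flat_tendsto_0[of "m + 1"]])
         (auto simp: exp_flat_def eventually_at_filter)
    with 2 show ?thesis by (simp add: exp_flat_def has_field_derivative_iff)
  next
    case 3
    have "((\<lambda>t. exp (- 1 / t) / t ^ m) has_real_derivative
        (exp (- 1 / t) / t ^ (m + 2) - real m * (exp (- 1 / t) / t ^ (m + 1)))) (at t)"
      using 3 by (cases m) (auto intro!: derivative_eq_intros simp: divide_simps power2_eq_square algebra_simps,
          metis One_nat_def power_eq_if)
    then have "(exp_flat m has_real_derivative
        (exp (- 1 / t) / t ^ (m + 2) - real m * (exp (- 1 / t) / t ^ (m + 1)))) (at t)"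
      by (rule has_field_derivative_transform_within_open[where S = "{0<..}"])
         (use 3 in \<open>auto simp: exp_flat_def\<close>)
    with 3 show ?thesis by (simp add: exp_flat_def)
  qed
qed

lemma smooth_exp_flat: "smooth_fun (exp_flat m)"
proof -
  have "Ck_fun k (exp_flat m)" for k
  proof (induction k arbitrary: m)
    case 0
    have "isCont (exp_flat m) t" for t
      using DERIV_isCont exp_flat_has_derivative by blast
    then show ?case by (simp add: continuous_at_imp_continuous_on)
  next
    case (Suc k)
    show ?case
    proof (rule Ck_fun_SucI)
      show "(exp_flat m has_derivative
          (\<lambda>v. (exp_flat (m + 2) t + (- real m) * exp_flat (m + 1) t) * v)) (at t)" for t
        using exp_flat_has_derivative[of m t] by (simp add: has_field_derivative_def)
      show "Ck_fun k (\<lambda>t. (exp_flat (m + 2) t + (- real m) * exp_flat (m + 1) t) * v)" for v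
        by (intro Ck_fun_mult Ck_fun_add Ck_fun_const Suc)
    qed
  qed
  then show ?thesis by (simp add: smooth_fun_def)
qed

lemma smooth_step_exists:
  obtains s :: "real \<Rightarrow> real" where "smooth_fun s" "\<And>t. 0 \<le> s t" "\<And>t. s t \<le> 1"
    "\<And>t. t \<le> 0 \<Longrightarrow> s t = 0" "\<And>t. 1 \<le> t \<Longrightarrow> s t = 1"
proof
  let ?q = "exp_flat 0"
  \<comment> \<open>This is q t / (q t + q (1 - t)), with 1 - t in the shape required by
    \<open>smooth_affine\<close>. The denominator is positive because t and 1 - t are not both \<le>
    0.\<close>
  let ?s = "\<lambda>t. ?q t * inverse (?q t + ?q (t \<bullet> (- 1) + 1))"
  have pos: "?q t + ?q (t \<bullet> (- 1) + 1) > 0" for t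
    by (auto simp: exp_flat_def add_pos_pos)
  show "smooth_fun ?s"
    by (intro smooth_mult smooth_inverse smooth_add smooth_affine smooth_exp_flat) (use pos less_irrefl in metis)
  show "0 \<le> ?s t" for t
    using pos[of t] by (simp add: exp_flat_def)
  show "?s t \<le> 1" for t
    using pos[of t] by (simp add: divide_simps flip: divide_inverse) (auto simp: exp_flat_def)
  show "?s t = 0" if "t \<le> 0" for t using that by (simp add: exp_flat_def)
  show "?s t = 1" if "t \<ge> 1" for t using that by (simp add: exp_flat_def)
qed

lemma smooth_bump_exists:
  obtains b :: "real \<Rightarrow> real" where "smooth_fun b" "\<And>t. 0 \<le> b t" "\<And>t. b t \<le> 1"
    "\<And>t. \<bar>t\<bar> \<le> 1 \<Longrightarrow> b t = 1" "\<And>t. 2 \<le> \<bar>t\<bar> \<Longrightarrow> b t = 0"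
proof -
  obtain s :: "real \<Rightarrow> real" where s: "smooth_fun s" "\<And>t. 0 \<le> s t" "\<And>t. s t \<le> 1"
    "\<And>t. t \<le> 0 \<Longrightarrow> s t = 0" "\<And>t. 1 \<le> t \<Longrightarrow> s t = 1"
    using smooth_step_exists by blast
  show thesis
  proof
    let ?b = "\<lambda>t::real. s (t \<bullet> 1 + 2) * s (t \<bullet> (- 1) + 2)"
    show "smooth_fun ?b" by (intro smooth_mult smooth_affine s)
    show "0 \<le> ?b t" for t using s by simp
    show "?b t \<le> 1" for t using s mult_le_one by blast
    show "?b t = 1" if "\<bar>t\<bar> \<le> 1" for t using that s(5) by simp
    show "?b t = 0" if "2 \<le> \<bar>t\<bar>" for t using that s(4) by (cases "t \<ge> 0") auto
  qed
qed

text \<open>In the product rule each gradient is multiplied by the other factors, whose product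
  stays in [0, 1]. A bound by a plain sum lets one count only the factors active at a point.\<close>

lemma norm_grad_prod_le:
  assumes "finite I" "\<And>i. i \<in> I \<Longrightarrow> smooth_fun (f i)" "\<And>i x. i \<in> I \<Longrightarrow> 0 \<le> f i x"
    "\<And>i x. i \<in> I \<Longrightarrow> f i x \<le> 1"
  shows "norm (grad (\<lambda>x. \<Prod>i\<in>I. f i x) x) \<le> (\<Sum>i\<in>I. norm (grad (f i) x))"
  using assms
proof (induction I rule: finite_induct)
  case empty
  then show ?case by (simp add: grad_const)
next
  case (insert j I)
  have le1: "0 \<le> (\<Prod>i\<in>I. f i x)" "(\<Prod>i\<in>I. f i x) \<le> 1"
    using insert.prems by (auto intro: prod_nonneg prod_le_1)
  have fj: "0 \<le> f j x" "f j x \<le> 1"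
    using insert.prems by auto
  have "grad (\<lambda>x. \<Prod>i\<in>insert j I. f i x) x = grad (\<lambda>x. f j x * (\<Prod>i\<in>I. f i x)) x"
    using insert.hyps by simp
  also have "\<dots> = (\<Prod>i\<in>I. f i x) *\<^sub>R grad (f j) x + f j x *\<^sub>R grad (\<lambda>x. \<Prod>i\<in>I. f i x) x"
    using insert.prems by (intro grad_mult smooth_prod) auto
  also have "norm \<dots> \<le> norm (grad (f j) x) + norm (grad (\<lambda>x. \<Prod>i\<in>I. f i x) x)"
    by (rule norm_triangle_le)
       (use le1 fj in \<open>auto intro!: add_mono mult_left_le_one_le\<close>)
  also have "\<dots> \<le> norm (grad (f j) x) + (\<Sum>i\<in>I. norm (grad (f i) x))"
    using insert by simp
  finally show ?case
    using insert.hyps by simp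
qed

text \<open>What matters is that \<open>C\<close> is fixed before \<epsilon> and \<open>S\<close>,
  so that cutoffs at scale 2 ^ -k have gradients of order 2 ^ k. Bumps on a cubic grid with mesh
  proportional to \<epsilon> are combined; each point sees boundedly many of them.\<close>

lemma smooth_cutoff_exists:
  obtains C :: real where "C > 0"
    "\<And>\<epsilon> S. \<epsilon> > 0 \<Longrightarrow> bounded (S :: 'a::euclidean_space set) \<Longrightarrow>
      \<exists>\<psi>. smooth_fun \<psi> \<and> (\<forall>x. 0 \<le> \<psi> x \<and> \<psi> x \<le> 1) \<and> (\<forall>x\<in>S. \<psi> x = 1) \<and>
        (\<forall>x. \<psi> x \<noteq> 0 \<longrightarrow> (\<exists>y\<in>S. dist x y < \<epsilon>)) \<and> (\<forall>x. norm (grad \<psi> x) \<le> C / \<epsilon>)"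
proof -
  obtain b :: "real \<Rightarrow> real" where b: "smooth_fun b" "\<And>t. 0 \<le> b t" "\<And>t. b t \<le> 1"
    "\<And>t. \<bar>t\<bar> \<le> 1 \<Longrightarrow> b t = 1" "\<And>t. 2 \<le> \<bar>t\<bar> \<Longrightarrow> b t = 0"
    using smooth_bump_exists by blast
  have b0: "b t = 0" if "t \<notin> {-2..2}" for t
    using that by (intro b(5)) auto
  obtain B where B: "B > 0" "\<And>t. norm (grad b t) \<le> B"
    by (rule smooth_compact_support_grad_bounded[OF b(1) compact_Icc[of "- 2" 2] b0])
       (auto intro: that)
  let ?n = "real DIM('a)"
  \<comment> \<open>At most 5 ^ n bumps are active at a point; each has n coordinate factors with
    gradient at most B / \<mu>, and \<mu> = \<epsilon> / (3 n) gives the last factor.\<close>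
  define C where "C = 5 ^ DIM('a) * (?n * (B * (3 * ?n)))"
  have n: "?n > 0" by simp
  show thesis
  proof
    show "C > 0" using n B by (simp add: C_def)
    fix \<epsilon> :: real and S :: "'a set"
    assume \<epsilon>: "\<epsilon> > 0" and S: "bounded S"
    \<comment> \<open>A bump reaches less than 2 \<mu> from its node in each coordinate, and the
      node lies within \<mu> of a point of \<open>S\<close>; so the l1 distance to that point is
      below 3 n \<mu> = \<epsilon>.\<close>
    define \<mu> where "\<mu> = \<epsilon> / (3 * ?n)"
    have \<mu>: "\<mu> > 0" using \<epsilon> n by (simp add: \<mu>_def)
    \<comment> \<open>\<open>J\<close> collects the grid nodes close to \<open>S\<close>, and
      \<open>N x\<close> those whose bump can be nonzero at \<open>x\<close>. Nodes are extensional
      functions on \<open>Basis\<close>, so boundedness of \<open>S\<close> makes \<open>J\<close>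
      finite.\<close>
    define J where "J = {m \<in> Basis \<rightarrow>\<^sub>E (UNIV :: int set). \<exists>y\<in>S. \<forall>i\<in>Basis. \<bar>y \<bullet> i / \<mu> - m i\<bar> \<le> 1}"
    define N where "N x = {m \<in> Basis \<rightarrow>\<^sub>E (UNIV :: int set). \<forall>i\<in>Basis. \<bar>x \<bullet> i / \<mu> - m i\<bar> < 2}" for x :: 'a
    define \<beta> where "\<beta> m i x = b (x \<bullet> (i /\<^sub>R \<mu>) + - real_of_int (m i))" for m :: "'a \<Rightarrow> int" and i x :: 'a
    define \<beta>\<beta> where "\<beta>\<beta> m x = (\<Prod>i\<in>Basis. \<beta> m i x)" for m x
    \<comment> \<open>One bump equal to 1 annihilates the product and makes \<psi> equal to 1; where
      all bumps vanish, so does \<psi>.\<close>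
    define \<psi> where "\<psi> x = 1 - (\<Prod>m\<in>J. 1 - \<beta>\<beta> m x)" for x
    have \<beta>_eq: "\<beta> m i x = b (x \<bullet> i / \<mu> - m i)" for m i x
      by (simp add: \<beta>_def divide_inverse mult.commute)
    have "finite J"
    proof -
      obtain R where R: "\<And>y. y \<in> S \<Longrightarrow> norm y \<le> R" using S by (auto simp: bounded_iff)
      have "m i \<in> {- \<lceil>R / \<mu> + 1\<rceil>..\<lceil>R / \<mu> + 1\<rceil>}" if m: "m \<in> J" and i: "i \<in> Basis" for m i
      proof -
        have "\<exists>y\<in>S. \<forall>i\<in>Basis. \<bar>y \<bullet> i / \<mu> - m i\<bar> \<le> 1"
          using m by (simp add: J_def)
        then obtain y where y: "y \<in> S" "\<bar>y \<bullet> i / \<mu> - m i\<bar> \<le> 1"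
          using i by blast
        have "\<bar>y \<bullet> i\<bar> \<le> R"
          using Basis_le_norm[OF i, of y] R[OF y(1)] by simp
        then have "\<bar>y \<bullet> i / \<mu>\<bar> \<le> R / \<mu>"
          using \<mu> by (simp add: divide_right_mono)
        then have "\<bar>real_of_int (m i)\<bar> \<le> R / \<mu> + 1"
          using y(2) by linarith
        then have "real_of_int (m i) \<le> R / \<mu> + 1" "- real_of_int (m i) \<le> R / \<mu> + 1"
          by linarith+
        then show ?thesis unfolding atLeastAtMost_iff by linarith
      qed
      then have "J \<subseteq> Basis \<rightarrow>\<^sub>E {- \<lceil>R / \<mu> + 1\<rceil>..\<lceil>R / \<mu> + 1\<rceil>}"
        by (auto simp: J_def PiE_def Pi_def)
      then show ?thesis
        by (rule finite_subset) (auto intro!: finite_PiE)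
    qed
    have \<beta>01: "0 \<le> \<beta> m i x" "\<beta> m i x \<le> 1" for m i x
      using b by (auto simp: \<beta>_def)
    have \<beta>\<beta>01: "0 \<le> \<beta>\<beta> m x" "\<beta>\<beta> m x \<le> 1" for m x
      unfolding \<beta>\<beta>_def using \<beta>01 by (auto intro: prod_nonneg prod_le_1)
    have s\<beta>: "smooth_fun (\<beta> m i)" for m i
      unfolding \<beta>_def[abs_def] by (intro smooth_affine b)
    have s\<beta>\<beta>: "smooth_fun (\<beta>\<beta> m)" for m
      unfolding \<beta>\<beta>_def[abs_def] by (intro smooth_intros s\<beta>)
    have g\<beta>: "norm (grad (\<beta> m i) x) \<le> B / \<mu>" if "i \<in> Basis" for m i x
    proof -
      let ?t = "x \<bullet> (i /\<^sub>R \<mu>) + - real_of_int (m i)"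
      have "(\<beta> m i has_derivative (\<lambda>v. grad b ?t \<bullet> (v \<bullet> (i /\<^sub>R \<mu>)))) (at x)"
        unfolding \<beta>_def[abs_def]
        by (rule has_derivative_compose[OF _ smooth_has_derivative[OF b(1)]])
           (auto intro!: derivative_eq_intros)
      then have "(\<beta> m i has_derivative (\<lambda>v. (grad b ?t / \<mu>) *\<^sub>R i \<bullet> v)) (at x)"
        by (rule back_subst[where P = "\<lambda>f. (\<beta> m i has_derivative f) (at x)"])
           (auto simp: inner_commute divide_inverse)
      then have "grad (\<beta> m i) x = (grad b ?t / \<mu>) *\<^sub>R i" by (rule grad_eqI)
      then show ?thesis
        using B(2)[of ?t] \<mu> that by (simp add: divide_right_mono)
    qed
    have g\<beta>\<beta>: "norm (grad (\<beta>\<beta> m) x) \<le> ?n * (B / \<mu>)" for m x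
    proof -
      have "norm (grad (\<beta>\<beta> m) x) \<le> (\<Sum>i\<in>Basis. norm (grad (\<beta> m i) x))"
        unfolding \<beta>\<beta>_def[abs_def] by (rule norm_grad_prod_le) (auto simp: s\<beta> \<beta>01)
      also have "\<dots> \<le> (\<Sum>i\<in>(Basis::'a set). B / \<mu>)"
        by (intro sum_mono g\<beta>)
      finally show ?thesis by simp
    qed
    have notN: "\<beta>\<beta> m x = 0" if m: "m \<in> J" "m \<notin> N x" for m x
    proof -
      obtain i where i: "i \<in> Basis" "\<bar>x \<bullet> i / \<mu> - m i\<bar> \<ge> 2"
        using m by (auto simp: N_def J_def not_less)
      then have "\<beta> m i x = 0" by (simp add: \<beta>_eq b)
      then show ?thesis using i(1) by (auto simp: \<beta>\<beta>_def)
    qed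
    have cardN: "card (N x) \<le> 5 ^ DIM('a)" and finN: "finite (N x)" for x
    proof -
      \<comment> \<open>An integer at distance below 2 from a real number differs from its floor by
        at most 2: five candidates per coordinate.\<close>
      let ?P = "PiE Basis (\<lambda>i. {\<lfloor>x \<bullet> i / \<mu>\<rfloor> - 2..\<lfloor>x \<bullet> i / \<mu>\<rfloor> + 2})"
      have "m i \<in> {\<lfloor>x \<bullet> i / \<mu>\<rfloor> - 2..\<lfloor>x \<bullet> i / \<mu>\<rfloor> + 2}" if "m \<in> N x" "i \<in> Basis" for m i
      proof -
        have "\<bar>x \<bullet> i / \<mu> - m i\<bar> < 2" using that by (auto simp: N_def)
        then show ?thesis unfolding atLeastAtMost_iff by linarith
      qed
      then have sub: "N x \<subseteq> ?P" by (auto simp: N_def PiE_def Pi_def)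
      moreover have fin: "finite ?P" by (intro finite_PiE) auto
      moreover have "card ?P = 5 ^ DIM('a)" by (simp add: card_PiE)
      ultimately show "card (N x) \<le> 5 ^ DIM('a)" "finite (N x)"
        using card_mono[OF fin sub] finite_subset by auto
    qed
    show "\<exists>\<psi>. smooth_fun \<psi> \<and> (\<forall>x. 0 \<le> \<psi> x \<and> \<psi> x \<le> 1) \<and> (\<forall>x\<in>S. \<psi> x = 1) \<and>
        (\<forall>x. \<psi> x \<noteq> 0 \<longrightarrow> (\<exists>y\<in>S. dist x y < \<epsilon>)) \<and> (\<forall>x. norm (grad \<psi> x) \<le> C / \<epsilon>)"
    proof (intro exI[of _ \<psi>] conjI allI ballI impI)
      show "smooth_fun \<psi>"
        unfolding \<psi>_def[abs_def] by (intro smooth_intros s\<beta>\<beta>)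
      fix x
      have "0 \<le> (\<Prod>m\<in>J. 1 - \<beta>\<beta> m x)" "(\<Prod>m\<in>J. 1 - \<beta>\<beta> m x) \<le> 1"
        using \<beta>\<beta>01 by (auto intro: prod_nonneg prod_le_1)
      then show "0 \<le> \<psi> x" "\<psi> x \<le> 1" by (auto simp: \<psi>_def)
      show "\<psi> x = 1" if "x \<in> S"
      proof -
        define m where "m = (\<lambda>i\<in>Basis. \<lfloor>x \<bullet> i / \<mu>\<rfloor>)"
        have le: "\<bar>x \<bullet> i / \<mu> - m i\<bar> \<le> 1" if "i \<in> Basis" for i
          using that by (simp add: m_def) linarith
        have "m \<in> Basis \<rightarrow>\<^sub>E UNIV" by (simp add: m_def)
        then have "m \<in> J" using \<open>x \<in> S\<close> le unfolding J_def by blast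
        moreover have "\<beta>\<beta> m x = 1"
          unfolding \<beta>\<beta>_def \<beta>_eq using le b(4) by (intro prod.neutral) auto
        ultimately show ?thesis
          using \<open>finite J\<close> by (auto simp: \<psi>_def)
      qed
      show "\<exists>y\<in>S. dist x y < \<epsilon>" if nz: "\<psi> x \<noteq> 0"
      proof -
        have "\<not> (\<forall>m\<in>J. \<beta>\<beta> m x = 0)"
        proof
          assume "\<forall>m\<in>J. \<beta>\<beta> m x = 0"
          then have "(\<Prod>m\<in>J. 1 - \<beta>\<beta> m x) = 1" by (intro prod.neutral) auto
          with nz show False by (simp add: \<psi>_def)
        qed
        then obtain m where m: "m \<in> J" "\<beta>\<beta> m x \<noteq> 0"
          by blast
        then have "m \<in> N x" using notN by blast
        have "\<exists>y\<in>S. \<forall>i\<in>Basis. \<bar>y \<bullet> i / \<mu> - m i\<bar> \<le> 1"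
          using m(1) by (simp add: J_def)
        then obtain y where y: "y \<in> S" "\<And>i. i \<in> Basis \<Longrightarrow> \<bar>y \<bullet> i / \<mu> - m i\<bar> \<le> 1"
          by blast
        have "\<bar>(x - y) \<bullet> i\<bar> < 3 * \<mu>" if "i \<in> Basis" for i
        proof -
          have "\<bar>x \<bullet> i / \<mu> - m i\<bar> < 2" using \<open>m \<in> N x\<close> that by (auto simp: N_def)
          with y(2)[OF that] have "\<bar>x \<bullet> i / \<mu> - y \<bullet> i / \<mu>\<bar> < 3" by linarith
          then have "\<bar>(x - y) \<bullet> i\<bar> / \<mu> < 3"
            using \<mu> by (simp add: inner_diff_left flip: diff_divide_distrib)
          then show ?thesis using \<mu> by (simp add: divide_simps)
        qed
        then have "(\<Sum>i\<in>Basis. \<bar>(x - y) \<bullet> i\<bar>) < (\<Sum>i\<in>(Basis::'a set). 3 * \<mu>)"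
          by (intro sum_strict_mono) auto
        then have "norm (x - y) < ?n * (3 * \<mu>)"
          using norm_le_l1[of "x - y"] by simp
        also have "?n * (3 * \<mu>) = \<epsilon>" using n by (simp add: \<mu>_def)
        finally show ?thesis using y(1) by (auto simp: dist_norm)
      qed
      show "norm (grad \<psi> x) \<le> C / \<epsilon>"
      proof -
        have "grad \<psi> x = - grad (\<lambda>x. \<Prod>m\<in>J. 1 - \<beta>\<beta> m x) x"
          unfolding \<psi>_def[abs_def]
          by (subst grad_diff) (auto intro!: smooth_intros s\<beta>\<beta> simp: grad_const)
        also have "norm \<dots> \<le> (\<Sum>m\<in>J. norm (grad (\<lambda>x. 1 - \<beta>\<beta> m x) x))"
          unfolding norm_minus_cancel
          by (rule norm_grad_prod_le) (auto intro!: smooth_intros s\<beta>\<beta> \<open>finite J\<close> simp: \<beta>\<beta>01)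
        also have "\<dots> = (\<Sum>m\<in>J. norm (grad (\<beta>\<beta> m) x))"
          by (subst grad_diff) (auto intro!: smooth_intros s\<beta>\<beta> simp: grad_const)
        \<comment> \<open>Only active bumps contribute: the others attain their minimum 0 at
          \<open>x\<close>.\<close>
        also have "\<dots> = (\<Sum>m\<in>J \<inter> N x. norm (grad (\<beta>\<beta> m) x))"
        proof (intro sum.mono_neutral_right ballI)
          fix m assume "m \<in> J - J \<inter> N x"
          then have "\<beta>\<beta> m x = 0" using notN by blast
          then have "grad (\<beta>\<beta> m) x = 0"
            by (intro grad_local_min s\<beta>\<beta>) (simp add: \<beta>\<beta>01)
          then show "norm (grad (\<beta>\<beta> m) x) = 0" by simp
        qed (use \<open>finite J\<close> in auto)
        also have "\<dots> \<le> of_nat (card (J \<inter> N x)) * (?n * (B / \<mu>))"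
          by (intro sum_bounded_above g\<beta>\<beta>)
        also have "\<dots> \<le> 5 ^ DIM('a) * (?n * (B / \<mu>))"
        proof (intro mult_right_mono)
          have "card (J \<inter> N x) \<le> 5 ^ DIM('a)"
            using card_mono[OF finN, of "J \<inter> N x" x] cardN[of x] by simp
          then show "real (card (J \<inter> N x)) \<le> 5 ^ DIM('a)"
            by (metis of_nat_le_iff of_nat_numeral of_nat_power)
        qed (use n B \<mu> in simp)
        also have "\<dots> = C / \<epsilon>"
          using n \<epsilon> by (simp add: C_def \<mu>_def field_simps)
        finally show ?thesis .
      qed
    qed
  qed
qed

subsection \<open>Series of averaged translations\<close>

lemma integrable_lborel_shift:
  fixes f :: "'a::euclidean_space \<Rightarrow> 'b::{banach, second_countable_topology}"
  assumes "integrable lborel f"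
  shows "integrable lborel (\<lambda>x. f (x + c))"
proof -
  have f: "integrable (distr lborel borel ((+) c)) f"
    using assms by (simp add: lborel_distr_plus)
  have "integrable lborel (\<lambda>x. f (c + x))"
    by (rule integrable_distr[OF _ f]) simp
  then show ?thesis by (simp add: add.commute)
qed

lemma integral_lborel_shift:
  fixes f :: "'a::euclidean_space \<Rightarrow> 'b::{banach, second_countable_topology}"
  assumes [measurable]: "f \<in> borel_measurable borel"
  shows "(\<integral>x. f (x + c) \<partial>lborel) = (\<integral>x. f x \<partial>lborel)"
proof -
  have "(\<integral>x. f x \<partial>lborel) = (\<integral>x. f x \<partial>(distr lborel borel ((+) c)))"
    by (simp add: lborel_distr_plus)
  also have "\<dots> = (\<integral>x. f (c + x) \<partial>lborel)"
    by (rule integral_distr) auto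
  finally show ?thesis by (simp add: add.commute)
qed

lemma integral_lborel_shift_minus:
  fixes f :: "'a::euclidean_space \<Rightarrow> 'b::{banach, second_countable_topology}"
  assumes "f \<in> borel_measurable borel"
  shows "(\<integral>x. f (x - c) \<partial>lborel) = (\<integral>x. f x \<partial>lborel)"
  using integral_lborel_shift[OF assms, of "- c"] by simp

text \<open>A common form for pure translations (\<open>q = 0\<close>) and averages over the segment
  from \<open>p\<close> to \<open>p + q\<close>. The subtraction makes it a transport of mass from
  \<open>x\<close> to \<open>x + (p + t *\<^sub>R q)\<close>, so the adjoint has the signs of
  \<open>p\<close> and \<open>q\<close> reversed.\<close>

definition segment_avg ::
    "'a::euclidean_space \<Rightarrow> 'a \<Rightarrow> ('a \<Rightarrow> 'b::{banach, second_countable_topology}) \<Rightarrow> 'a \<Rightarrow> 'b" where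
  "segment_avg p q f y = (\<integral>t. indicator {0..1} t *\<^sub>R f (y - (p + t *\<^sub>R q)) \<partial>(lborel :: real measure))"

text \<open>For fixed t in [0, 1] the slice is a translate of \<open>f\<close>, with the same norm
  integral; as the interval has length 1, Tonelli gives joint integrability.\<close>

lemma integrable_segment_pair:
  fixes f :: "'a::euclidean_space \<Rightarrow> 'b::{banach, second_countable_topology}"
  assumes f: "integrable lborel f"
  shows "integrable (lborel \<Otimes>\<^sub>M lborel)
    (\<lambda>(y, t). indicator {0..1} (t::real) *\<^sub>R f (y - (p + t *\<^sub>R q)))"
proof -
  have [measurable]: "f \<in> borel_measurable borel"
    using borel_measurable_integrable[OF f] by simp
  have n: "(\<integral>y. norm (indicator {0..1} t *\<^sub>R f (y - (p + t *\<^sub>R q))) \<partial>lborel)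
      = indicator {0..1} t * (\<integral>x. norm (f x) \<partial>lborel)" for t :: real
    using integral_lborel_shift_minus[of "\<lambda>x. norm (f x)" "p + t *\<^sub>R q"] by simp
  have "integrable (lborel \<Otimes>\<^sub>M lborel)
    (\<lambda>(t, y). indicator {0..1} (t::real) *\<^sub>R f (y - (p + t *\<^sub>R q)))"
  proof (rule lborel_pair.Fubini_integrable)
    show "(\<lambda>(t, y). indicator {0..1} (t::real) *\<^sub>R f (y - (p + t *\<^sub>R q)))
        \<in> borel_measurable (lborel \<Otimes>\<^sub>M lborel)"
      unfolding split_beta' by measurable
    show "integrable lborel (\<lambda>t. \<integral>y. norm (case (t, y) of (t, y) \<Rightarrow>
        indicator {0..1} (t::real) *\<^sub>R f (y - (p + t *\<^sub>R q))) \<partial>lborel)"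
      unfolding prod.case n by simp
    show "AE t in lborel. integrable lborel (\<lambda>y. case (t, y) of (t, y) \<Rightarrow>
        indicator {0..1} (t::real) *\<^sub>R f (y - (p + t *\<^sub>R q)))"
    proof (rule AE_I2)
      fix t :: real
      have "integrable lborel (\<lambda>y. f (y - (p + t *\<^sub>R q)))"
        using integrable_lborel_shift[OF f, of "- (p + t *\<^sub>R q)"]
        unfolding diff_conv_add_uminus .
      then show "integrable lborel (\<lambda>y. case (t, y) of (t, y) \<Rightarrow>
          indicator {0..1} (t::real) *\<^sub>R f (y - (p + t *\<^sub>R q)))"
        by simp
    qed
  qed
  \<comment> \<open>Tonelli was used with t outermost, where the inner integral is a translation;
    the claim has the other order.\<close>
  then show ?thesis
    by (subst (asm) lborel_pair.integrable_product_swap_iff[symmetric]) simp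
qed

text \<open>A merely integrable \<open>f\<close> may fail to be integrable along the segment for
  some \<open>y\<close>, where the Bochner integral defaults to 0. The a.e. statement later permits
  inner products and sums to pass through \<open>segment_avg\<close>.\<close>

lemma
  fixes f :: "'a::euclidean_space \<Rightarrow> 'b::{banach, second_countable_topology}"
  assumes f: "integrable lborel f"
  shows integrable_segment_avg: "integrable lborel (segment_avg p q f)"
    and AE_segment_avg: "AE y in lborel. integrable lborel
        (\<lambda>t. indicator {0..1} (t::real) *\<^sub>R f (y - (p + t *\<^sub>R q)))"
    and integral_norm_segment_avg_le:
      "(\<integral>y. norm (segment_avg p q f y) \<partial>lborel) \<le> (\<integral>y. norm (f y) \<partial>lborel)"
proof -
  note I = integrable_segment_pair[OF f, of p q]
  have [measurable]: "f \<in> borel_measurable borel"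
    using borel_measurable_integrable[OF f] by simp
  show i: "integrable lborel (segment_avg p q f)"
    using lborel_pair.integrable_fst[OF I] by (simp add: segment_avg_def[abs_def])
  show "AE y in lborel. integrable lborel
        (\<lambda>t. indicator {0..1} (t::real) *\<^sub>R f (y - (p + t *\<^sub>R q)))"
    using lborel_pair.AE_integrable_fst[OF I] .
  have I': "integrable (lborel \<Otimes>\<^sub>M lborel)
    (\<lambda>(y, t). indicator {0..1} (t::real) *\<^sub>R norm (f (y - (p + t *\<^sub>R q))))"
    by (rule integrable_segment_pair) (use f in simp)
  have "(\<integral>y. norm (segment_avg p q f y) \<partial>lborel)
      \<le> (\<integral>y. (\<integral>t. indicator {0..1} (t::real) *\<^sub>R norm (f (y - (p + t *\<^sub>R q))) \<partial>lborel) \<partial>lborel)"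
  proof (rule integral_mono)
    show "norm (segment_avg p q f y)
        \<le> (\<integral>t. indicator {0..1} (t::real) *\<^sub>R norm (f (y - (p + t *\<^sub>R q))) \<partial>lborel)" for y
      using integral_norm_bound[of lborel "\<lambda>t. indicator {0..1} (t::real) *\<^sub>R f (y - (p + t *\<^sub>R q))"]
      by (simp add: segment_avg_def)
  qed (use i lborel_pair.integrable_fst[OF I'] in auto)
  also have "\<dots> = (\<integral>t. (\<integral>y. indicator {0..1} (t::real) *\<^sub>R norm (f (y - (p + t *\<^sub>R q))) \<partial>lborel) \<partial>lborel)"
    by (rule lborel_pair.Fubini_integral[symmetric]) (rule I')
  also have "\<dots> = (\<integral>t. indicator {0..1} (t::real) *\<^sub>R (\<integral>x. norm (f x) \<partial>lborel) \<partial>lborel)"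
    using integral_lborel_shift_minus[of "\<lambda>x. norm (f x)"] by simp
  also have "\<dots> = (\<integral>x. norm (f x) \<partial>lborel)"
    by simp
  finally show "(\<integral>y. norm (segment_avg p q f y) \<partial>lborel) \<le> (\<integral>y. norm (f y) \<partial>lborel)" .
qed

lemma integrable_inner_bounded:
  fixes f G :: "'a::euclidean_space \<Rightarrow> 'a"
  assumes f: "integrable M f" and G: "G \<in> borel_measurable M" "\<And>x. norm (G x) \<le> B"
  shows "integrable M (\<lambda>x. f x \<bullet> G x)"
proof (rule Bochner_Integration.integrable_bound)
  show "integrable M (\<lambda>x. B * norm (f x))" using f by simp
  show "(\<lambda>x. f x \<bullet> G x) \<in> borel_measurable M" using f G by simp
  show "AE x in M. norm (f x \<bullet> G x) \<le> norm (B * norm (f x))"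
  proof (rule AE_I2)
    fix x
    have "norm (f x \<bullet> G x) \<le> norm (f x) * norm (G x)" by (simp add: Cauchy_Schwarz_ineq2)
    also have "\<dots> \<le> norm (f x) * B" using G by (intro mult_left_mono) auto
    finally show "norm (f x \<bullet> G x) \<le> norm (B * norm (f x))"
      by (smt (verit) mult.commute real_norm_def)
  qed
qed

text \<open>Fubini moves t outside, the translation by \<open>p + t *\<^sub>R q\<close> moves the
  shift from \<open>f\<close> to \<open>G\<close>, and Fubini moves t back inside. Boundedness of
  \<open>G\<close> gives integrability for both exchanges.\<close>

lemma segment_avg_adjoint:
  fixes f G :: "'a::euclidean_space \<Rightarrow> 'a"
  assumes f: "integrable lborel f" and G: "continuous_on UNIV G" "\<And>x. norm (G x) \<le> B"
  shows "(\<integral>y. segment_avg p q f y \<bullet> G y \<partial>lborel)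
    = (\<integral>x. f x \<bullet> segment_avg (- p) (- q) G x \<partial>lborel)" (is "?L = ?R")
proof -
  have [measurable]: "f \<in> borel_measurable borel"
    using borel_measurable_integrable[OF f] by simp
  have [measurable]: "G \<in> borel_measurable borel"
    using G by (intro borel_measurable_continuous_onI)
  have "integrable (lborel \<Otimes>\<^sub>M lborel)
      (\<lambda>z. (case z of (y, t) \<Rightarrow> indicator {0..1} (t::real) *\<^sub>R f (y - (p + t *\<^sub>R q))) \<bullet> G (fst z))"
  proof (rule Bochner_Integration.integrable_bound)
    show "integrable (lborel \<Otimes>\<^sub>M lborel)
        (\<lambda>z. B * norm (case z of (y, t) \<Rightarrow> indicator {0..1} (t::real) *\<^sub>R f (y - (p + t *\<^sub>R q))))"
      using integrable_segment_pair[OF f, of p q] by simp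
    show "AE z in lborel \<Otimes>\<^sub>M lborel.
        norm ((case z of (y, t) \<Rightarrow> indicator {0..1} (t::real) *\<^sub>R f (y - (p + t *\<^sub>R q))) \<bullet> G (fst z))
        \<le> norm (B * norm (case z of (y, t) \<Rightarrow> indicator {0..1} (t::real) *\<^sub>R f (y - (p + t *\<^sub>R q))))"
    proof (rule AE_I2)
      fix z :: "'a \<times> real"
      let ?h = "case z of (y, t) \<Rightarrow> indicator {0..1} (t::real) *\<^sub>R f (y - (p + t *\<^sub>R q))"
      have "norm (?h \<bullet> G (fst z)) \<le> norm ?h * norm (G (fst z))" by (simp add: Cauchy_Schwarz_ineq2)
      also have "\<dots> \<le> norm ?h * B" using G by (intro mult_left_mono) auto
      finally show "norm (?h \<bullet> G (fst z)) \<le> norm (B * norm ?h)"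
        by (smt (verit) mult.commute real_norm_def)
    qed
  qed (unfold split_beta', measurable)
  then have I: "integrable (lborel \<Otimes>\<^sub>M lborel)
      (\<lambda>(y, t). (indicator {0..1} (t::real) *\<^sub>R f (y - (p + t *\<^sub>R q))) \<bullet> G y)"
    by (simp add: split_beta')
  have s: "(\<integral>y. (indicator {0..1} (t::real) *\<^sub>R f (y - (p + t *\<^sub>R q))) \<bullet> G y \<partial>lborel)
      = (\<integral>x. indicator {0..1} t *\<^sub>R (f x \<bullet> G (x + (p + t *\<^sub>R q))) \<partial>lborel)" for t
    using integral_lborel_shift_minus[of "\<lambda>x. indicator {0..1} t *\<^sub>R (f x \<bullet> G (x + (p + t *\<^sub>R q)))" "p + t *\<^sub>R q"]
    by simp
  have "?L = (\<integral>y. (\<integral>t. (indicator {0..1} (t::real) *\<^sub>R f (y - (p + t *\<^sub>R q))) \<bullet> G y \<partial>lborel) \<partial>lborel)"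
  proof (rule integral_cong_AE)
    show "AE y in lborel. segment_avg p q f y \<bullet> G y =
        (\<integral>t. (indicator {0..1} (t::real) *\<^sub>R f (y - (p + t *\<^sub>R q))) \<bullet> G y \<partial>lborel)"
      using AE_segment_avg[OF f, of p q]
    proof eventually_elim
      case (elim y)
      then show ?case unfolding segment_avg_def by (intro integral_inner_left[symmetric])
    qed
    show "(\<lambda>y. segment_avg p q f y \<bullet> G y) \<in> borel_measurable lborel"
      using integrable_segment_avg[OF f, of p q] by simp
    show "(\<lambda>y. \<integral>t. (indicator {0..1} (t::real) *\<^sub>R f (y - (p + t *\<^sub>R q))) \<bullet> G y \<partial>lborel) \<in> borel_measurable lborel"
      using lborel_pair.integrable_fst[OF I] by simp
  qed
  also have "\<dots> = (\<integral>t. (\<integral>y. (indicator {0..1} (t::real) *\<^sub>R f (y - (p + t *\<^sub>R q))) \<bullet> G y \<partial>lborel) \<partial>lborel)"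
    by (rule lborel_pair.Fubini_integral[symmetric, OF I])
  also have "\<dots> = (\<integral>t. (\<integral>x. (indicator {0..1} (t::real) *\<^sub>R (f x \<bullet> G (x + (p + t *\<^sub>R q)))) \<partial>lborel) \<partial>lborel)"
    unfolding s ..
  also have "\<dots> = (\<integral>x. (\<integral>t. (indicator {0..1} (t::real) *\<^sub>R (f x \<bullet> G (x + (p + t *\<^sub>R q)))) \<partial>lborel) \<partial>lborel)"
  proof (rule lborel_pair.Fubini_integral)
    \<comment> \<open>With \<open>p\<close> and \<open>q\<close> both 0 this yields the joint
      majorant: B times the norm of \<open>f x\<close>, for t in [0, 1].\<close>
    have "integrable (lborel \<Otimes>\<^sub>M lborel) (\<lambda>(x, t). norm (indicator {0..1} (t::real) *\<^sub>R f (x - (0 + t *\<^sub>R 0))))"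
      using integrable_norm[OF integrable_segment_pair[OF f, of 0 0]] by (simp add: split_beta')
    then have n: "integrable (lborel \<Otimes>\<^sub>M lborel) (\<lambda>(x, t). B * (indicator {0..1} (t::real) * norm (f x)))"
      by (simp add: split_beta')
    show "integrable (lborel \<Otimes>\<^sub>M lborel) (\<lambda>(x, t). indicator {0..1} (t::real) *\<^sub>R (f x \<bullet> G (x + (p + t *\<^sub>R q))))"
    proof (rule Bochner_Integration.integrable_bound[OF n])
      show "AE z in lborel \<Otimes>\<^sub>M lborel.
          norm (case z of (x, t) \<Rightarrow> indicator {0..1} (t::real) *\<^sub>R (f x \<bullet> G (x + (p + t *\<^sub>R q))))
          \<le> norm (case z of (x, t) \<Rightarrow> B * (indicator {0..1} (t::real) * norm (f x)))"
      proof (rule AE_I2)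
        fix z :: "'a \<times> real"
        obtain x t where z: "z = (x, t)" by (cases z)
        have "\<bar>f x \<bullet> G (x + (p + t *\<^sub>R q))\<bar> \<le> norm (f x) * norm (G (x + (p + t *\<^sub>R q)))"
          by (simp add: Cauchy_Schwarz_ineq2)
        also have "\<dots> \<le> norm (f x) * B" using G by (intro mult_left_mono) auto
        finally have *: "\<bar>f x \<bullet> G (x + (p + t *\<^sub>R q))\<bar> \<le> B * norm (f x)" by (simp add: mult.commute)
        show "norm (case z of (x, t) \<Rightarrow> indicator {0..1} (t::real) *\<^sub>R (f x \<bullet> G (x + (p + t *\<^sub>R q))))
          \<le> norm (case z of (x, t) \<Rightarrow> B * (indicator {0..1} (t::real) * norm (f x)))"
          using * unfolding z by (auto simp: indicator_def)
      qed
    qed (unfold split_beta', measurable)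
  qed
  also have "\<dots> = ?R"
  proof (rule Bochner_Integration.integral_cong[OF refl])
    fix x
    have "integrable lborel (\<lambda>t. indicator {0..1} (t::real) *\<^sub>R G (x + (p + t *\<^sub>R q)))"
      by (rule borel_integrable_compact)
         (auto intro!: continuous_intros continuous_on_compose2[OF G(1)])
    then show "(\<integral>t. (indicator {0..1} (t::real) *\<^sub>R (f x \<bullet> G (x + (p + t *\<^sub>R q)))) \<partial>lborel)
        = f x \<bullet> segment_avg (- p) (- q) G x"
      unfolding segment_avg_def by (subst integral_inner_right[symmetric]) (auto simp: algebra_simps)
  qed
  finally show ?thesis .
qed

lemma norm_segment_avg_le:
  fixes G :: "'a::euclidean_space \<Rightarrow> 'a"
  assumes G: "continuous_on UNIV G" "\<And>x. norm (G x) \<le> B"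
  shows "norm (segment_avg p q G x) \<le> B"
proof -
  have "norm (segment_avg p q G x) \<le> (\<integral>t. norm (indicator {0..1} (t::real) *\<^sub>R G (x - (p + t *\<^sub>R q))) \<partial>lborel)"
    unfolding segment_avg_def by (rule integral_norm_bound)
  also have "\<dots> \<le> (\<integral>t. indicator {0..1} (t::real) *\<^sub>R B \<partial>lborel)"
  proof (rule integral_mono)
    show "integrable lborel (\<lambda>t. norm (indicator {0..1} (t::real) *\<^sub>R G (x - (p + t *\<^sub>R q))))"
      by (intro integrable_norm borel_integrable_compact)
         (auto intro!: continuous_intros continuous_on_compose2[OF G(1)])
    show "norm (indicator {0..1} t *\<^sub>R G (x - (p + t *\<^sub>R q))) \<le> indicator {0..1} t *\<^sub>R B" for t :: real
      using G by (auto simp: indicator_def)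
  qed simp
  finally show ?thesis by simp
qed

lemma segment_avg_measurable:
  fixes G :: "'a::euclidean_space \<Rightarrow> 'a"
  assumes [measurable]: "G \<in> borel_measurable borel"
  shows "segment_avg p q G \<in> borel_measurable borel"
proof -
  have "(\<lambda>y. \<integral>t. indicator {0..1} t *\<^sub>R G (y - (p + t *\<^sub>R q)) \<partial>(lborel :: real measure)) \<in> borel_measurable lborel"
    by measurable
  then show ?thesis by (simp add: segment_avg_def[abs_def])
qed

section \<open>Weighted series of translations on L1\<close>

lemma AE_summable_norm:
  fixes f :: "nat \<Rightarrow> 'a \<Rightarrow> 'b::{banach, second_countable_topology}"
  assumes f: "\<And>i. integrable M (f i)" and s: "summable (\<lambda>i. \<integral>x. norm (f i x) \<partial>M)"
  shows "AE x in M. summable (\<lambda>i. norm (f i x))"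
proof -
  have [measurable]: "f i \<in> borel_measurable M" for i using f by auto
  have "(\<integral>\<^sup>+x. (\<Sum>i. ennreal (norm (f i x))) \<partial>M) = (\<Sum>i. \<integral>\<^sup>+x. ennreal (norm (f i x)) \<partial>M)"
    by (rule nn_integral_suminf) auto
  also have "\<dots> = (\<Sum>i. ennreal (\<integral>x. norm (f i x) \<partial>M))"
    by (intro suminf_cong nn_integral_eq_integral integrable_norm f) auto
  also have "\<dots> = ennreal (\<Sum>i. \<integral>x. norm (f i x) \<partial>M)"
    by (intro suminf_ennreal2 s) auto
  finally have "(\<integral>\<^sup>+x. (\<Sum>i. ennreal (norm (f i x))) \<partial>M) \<noteq> \<infinity>"
    by simp
  then have "AE x in M. (\<Sum>i. ennreal (norm (f i x))) \<noteq> \<infinity>"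
    by (intro nn_integral_noteq_infinite) auto
  then show ?thesis
    by eventually_elim (auto intro: summable_suminf_not_top)
qed

text \<open>\<open>K k x\<close> is a matrix-valued weight. A pointwise bound on the sum of the
  norms, uniform in the number of terms, makes \<open>T\<close> bounded on L1 with the same
  constant, because transport along segments does not increase the L1 norm.\<close>

locale translation_series =
  fixes K :: "nat \<Rightarrow> 'a::euclidean_space \<Rightarrow> 'a \<Rightarrow> 'a" and p q :: "nat \<Rightarrow> 'a" and C :: real
  assumes linear_K: "\<And>k x. linear (K k x)"
    and measurable_K: "\<And>f k. f \<in> borel_measurable borel \<Longrightarrow> (\<lambda>x. K k x (f x)) \<in> borel_measurable borel"
    and sum_norm_K: "\<And>n x v. (\<Sum>k<n. norm (K k x v)) \<le> C * norm v"
begin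

definition T :: "('a \<Rightarrow> 'a) \<Rightarrow> 'a \<Rightarrow> 'a" where
  "T f y = (\<Sum>k. segment_avg (p k) (q k) (\<lambda>x. K k x (f x)) y)"

lemma norm_K_le: "norm (K k x v) \<le> C * norm v"
proof -
  have "norm (K k x v) \<le> (\<Sum>k<Suc k. norm (K k x v))"
    by (intro member_le_sum) auto
  then show ?thesis using sum_norm_K order_trans by blast
qed

context
  fixes f :: "'a \<Rightarrow> 'a"
  assumes f: "integrable lborel f"
begin

lemma integrable_K: "integrable lborel (\<lambda>x. K k x (f x))"
proof (rule Bochner_Integration.integrable_bound)
  show "integrable lborel (\<lambda>x. C * norm (f x))" using f by simp
  show "(\<lambda>x. K k x (f x)) \<in> borel_measurable lborel"
    using measurable_K[of f] f by auto
  show "AE x in lborel. norm (K k x (f x)) \<le> norm (C * norm (f x))"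
    using norm_K_le by (intro AE_I2) (smt (verit) real_norm_def)
qed

lemma sum_integral_norm_K:
  "(\<Sum>k<n. \<integral>x. norm (K k x (f x)) \<partial>lborel) \<le> C * (\<integral>x. norm (f x) \<partial>lborel)"
proof -
  have "(\<Sum>k<n. \<integral>x. norm (K k x (f x)) \<partial>lborel) = (\<integral>x. (\<Sum>k<n. norm (K k x (f x))) \<partial>lborel)"
    by (intro Bochner_Integration.integral_sum[symmetric] integrable_norm integrable_K)
  also have "\<dots> \<le> (\<integral>x. C * norm (f x) \<partial>lborel)"
    by (intro integral_mono sum_norm_K Bochner_Integration.integrable_sum integrable_norm integrable_K)
       (use f in simp)
  finally show ?thesis by simp
qed

lemma summable_integral_norm_K: "summable (\<lambda>k. \<integral>x. norm (K k x (f x)) \<partial>lborel)"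
proof (rule bounded_imp_summable)
  show "(\<Sum>k\<le>n. \<integral>x. norm (K k x (f x)) \<partial>lborel) \<le> C * (\<integral>x. norm (f x) \<partial>lborel)" for n
    using sum_integral_norm_K[of "Suc n"] by (simp add: lessThan_Suc_atMost)
qed simp

lemma suminf_integral_norm_K:
  "(\<Sum>k. \<integral>x. norm (K k x (f x)) \<partial>lborel) \<le> C * (\<integral>x. norm (f x) \<partial>lborel)"
  by (rule suminf_le_const[OF summable_integral_norm_K sum_integral_norm_K])

lemma summable_integral_norm_term:
  "summable (\<lambda>k. \<integral>y. norm (segment_avg (p k) (q k) (\<lambda>x. K k x (f x)) y) \<partial>lborel)"
  by (rule summable_comparison_test'[OF summable_integral_norm_K])
     (simp add: integral_norm_segment_avg_le[OF integrable_K])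

lemma AE_summable_term:
  "AE y in lborel. summable (\<lambda>k. norm (segment_avg (p k) (q k) (\<lambda>x. K k x (f x)) y))"
  by (intro AE_summable_norm integrable_segment_avg integrable_K summable_integral_norm_term)

lemma integrable_T: "integrable lborel (T f)"
  unfolding T_def[abs_def]
  by (intro integrable_suminf integrable_segment_avg integrable_K AE_summable_term
      summable_integral_norm_term)

lemma integral_norm_T_le: "(\<integral>y. norm (T f y) \<partial>lborel) \<le> C * (\<integral>x. norm (f x) \<partial>lborel)"
proof -
  let ?g = "\<lambda>k y. norm (segment_avg (p k) (q k) (\<lambda>x. K k x (f x)) y)"
  have g: "integrable lborel (?g k)" for k
    by (intro integrable_norm integrable_segment_avg integrable_K)
  have s: "AE y in lborel. summable (\<lambda>k. norm (?g k y))" "summable (\<lambda>k. \<integral>y. norm (?g k y) \<partial>lborel)"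
    using AE_summable_term summable_integral_norm_term by auto
  have "(\<integral>y. norm (T f y) \<partial>lborel) \<le> (\<integral>y. (\<Sum>k. ?g k y) \<partial>lborel)"
  proof (rule integral_mono_AE)
    show "AE y in lborel. norm (T f y) \<le> (\<Sum>k. ?g k y)"
      using AE_summable_term by eventually_elim (auto simp: T_def intro: summable_norm)
  qed (use integrable_T integrable_suminf[OF g s] in auto)
  also have "\<dots> = (\<Sum>k. \<integral>y. ?g k y \<partial>lborel)"
    by (rule integral_suminf[OF g s])
  also have "\<dots> \<le> (\<Sum>k. \<integral>x. norm (K k x (f x)) \<partial>lborel)"
    by (intro suminf_le integral_norm_segment_avg_le integrable_K summable_integral_norm_term
        summable_integral_norm_K)
  also have "\<dots> \<le> C * (\<integral>x. norm (f x) \<partial>lborel)"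
    by (rule suminf_integral_norm_K)
  finally show ?thesis .
qed

text \<open>As \<open>G\<close> is bounded by \<open>B\<close>, the norm integrals of both series
  are dominated by \<open>B\<close> times those of the terms for \<open>f\<close> alone. So sum and
  integral commute on either side, and the identity follows term by term.\<close>

lemma T_adjoint:
  assumes G: "continuous_on UNIV G" "\<And>x. norm (G x) \<le> B"
  defines "H \<equiv> \<lambda>x. \<Sum>k. K k x (f x) \<bullet> segment_avg (- p k) (- q k) G x"
  shows "integrable lborel H"
    and "(\<integral>y. T f y \<bullet> G y \<partial>lborel) = (\<integral>x. H x \<partial>lborel)"
proof -
  have [measurable]: "G \<in> borel_measurable borel"
    using G by (intro borel_measurable_continuous_onI)
  let ?g = "\<lambda>k y. segment_avg (p k) (q k) (\<lambda>x. K k x (f x)) y \<bullet> G y"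
  let ?h = "\<lambda>k x. K k x (f x) \<bullet> segment_avg (- p k) (- q k) G x"
  have "0 \<le> B" using G(2)[of 0] norm_ge_zero order_trans by blast
  have le: "norm (a \<bullet> b) \<le> B * norm a" if "norm b \<le> B" for a b :: 'a
  proof -
    have "norm (a \<bullet> b) \<le> norm a * norm b" by (simp add: Cauchy_Schwarz_ineq2)
    also have "\<dots> \<le> norm a * B" using that by (intro mult_left_mono) auto
    finally show ?thesis by (simp add: mult.commute)
  qed
  note leG = le[OF G(2)] and leS = le[OF norm_segment_avg_le[OF G]]
  have g: "integrable lborel (?g k)" for k
    by (rule integrable_inner_bounded[OF integrable_segment_avg[OF integrable_K] _ G(2)]) simp
  have h: "integrable lborel (?h k)" for k
    by (rule integrable_inner_bounded[OF integrable_K _ norm_segment_avg_le[OF G]])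
       (simp add: segment_avg_measurable)
  have ng: "(\<integral>y. norm (?g k y) \<partial>lborel)
      \<le> B * (\<integral>y. norm (segment_avg (p k) (q k) (\<lambda>x. K k x (f x)) y) \<partial>lborel)" for k
    unfolding integral_mult_right_zero[symmetric]
    by (intro integral_mono integrable_norm g integrable_mult_right integrable_segment_avg integrable_K leG)
  have nh: "(\<integral>x. norm (?h k x) \<partial>lborel) \<le> B * (\<integral>x. norm (K k x (f x)) \<partial>lborel)" for k
    unfolding integral_mult_right_zero[symmetric]
    by (intro integral_mono integrable_norm h integrable_mult_right integrable_K leS)
  have sg: "summable (\<lambda>k. \<integral>y. norm (?g k y) \<partial>lborel)"
    by (rule summable_comparison_test'[OF summable_mult[OF summable_integral_norm_term, of B]])
       (use ng in simp)
  have sh: "summable (\<lambda>k. \<integral>x. norm (?h k x) \<partial>lborel)"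
    by (rule summable_comparison_test'[OF summable_mult[OF summable_integral_norm_K, of B]])
       (use nh in simp)
  note ag = AE_summable_norm[OF g sg] and ah = AE_summable_norm[OF h sh]
  show "integrable lborel H"
    unfolding H_def by (rule integrable_suminf[OF h ah sh])
  have "(\<integral>y. T f y \<bullet> G y \<partial>lborel) = (\<integral>y. (\<Sum>k. ?g k y) \<partial>lborel)"
  proof (rule integral_cong_AE)
    show "AE y in lborel. T f y \<bullet> G y = (\<Sum>k. ?g k y)"
      using AE_summable_term
    proof eventually_elim
      case (elim y)
      then have "summable (\<lambda>k. segment_avg (p k) (q k) (\<lambda>x. K k x (f x)) y)"
        by (rule summable_norm_cancel)
      then show ?case
        unfolding T_def by (rule bounded_linear.suminf[OF bounded_linear_inner_left])
    qed
  qed (use integrable_T integrable_suminf[OF g ag sg] in auto)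
  also have "\<dots> = (\<Sum>k. \<integral>y. ?g k y \<partial>lborel)"
    by (rule integral_suminf[OF g ag sg])
  also have "\<dots> = (\<Sum>k. \<integral>x. ?h k x \<partial>lborel)"
    by (intro suminf_cong segment_avg_adjoint[OF integrable_K G])
  also have "\<dots> = (\<integral>x. H x \<partial>lborel)"
    unfolding H_def by (rule integral_suminf[OF h ah sh, symmetric])
  finally show "(\<integral>y. T f y \<bullet> G y \<partial>lborel) = (\<integral>x. H x \<partial>lborel)" .
qed

end

text \<open>Off one null set all countably many segment integrals exist and both series converge;
  there the linearity of \<open>K\<close> carries over termwise.\<close>

lemma T_linear_AE:
  assumes f: "integrable lborel f" and g: "integrable lborel g"
  shows "AE y in lborel. T (\<lambda>x. a *\<^sub>R f x + b *\<^sub>R g x) y = a *\<^sub>R T f y + b *\<^sub>R T g y"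
proof -
  let ?S = "\<lambda>k f. segment_avg (p k) (q k) (\<lambda>x. K k x (f x))"
  have "AE y in lborel. \<forall>k. ?S k (\<lambda>x. a *\<^sub>R f x + b *\<^sub>R g x) y = a *\<^sub>R ?S k f y + b *\<^sub>R ?S k g y"
    unfolding AE_all_countable
  proof
    fix k
    show "AE y in lborel. ?S k (\<lambda>x. a *\<^sub>R f x + b *\<^sub>R g x) y = a *\<^sub>R ?S k f y + b *\<^sub>R ?S k g y"
      using AE_segment_avg[OF integrable_K[OF f, where k = k], where p = "p k" and q = "q k"]
        AE_segment_avg[OF integrable_K[OF g, where k = k], where p = "p k" and q = "q k"]
    proof eventually_elim
      case (elim y)
      have "segment_avg (p k) (q k) (\<lambda>x. K k x (a *\<^sub>R f x + b *\<^sub>R g x)) y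
        = (\<integral>t. a *\<^sub>R (indicator {0..1} (t::real) *\<^sub>R K k (y - (p k + t *\<^sub>R q k)) (f (y - (p k + t *\<^sub>R q k))))
            + b *\<^sub>R (indicator {0..1} (t::real) *\<^sub>R K k (y - (p k + t *\<^sub>R q k)) (g (y - (p k + t *\<^sub>R q k)))) \<partial>lborel)"
        unfolding segment_avg_def
        by (simp add: linear_add[OF linear_K] linear_cmul[OF linear_K] scaleR_add_right mult.commute)
      also have "\<dots> = a *\<^sub>R ?S k f y + b *\<^sub>R ?S k g y"
        unfolding segment_avg_def
        by (subst Bochner_Integration.integral_add) (use elim in \<open>simp_all del: scaleR_scaleR\<close>)
      finally show ?case .
    qed
  qed
  then show ?thesis
    using AE_summable_term[OF f] AE_summable_term[OF g]
  proof eventually_elim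
    case (elim y)
    have sf: "summable (\<lambda>k. ?S k f y)" and sg: "summable (\<lambda>k. ?S k g y)"
      by (rule summable_norm_cancel, rule elim)+
    have "T (\<lambda>x. a *\<^sub>R f x + b *\<^sub>R g x) y = (\<Sum>k. a *\<^sub>R ?S k f y + b *\<^sub>R ?S k g y)"
      unfolding T_def by (intro suminf_cong) (rule spec[OF elim(1)])
    also have "\<dots> = (\<Sum>k. a *\<^sub>R ?S k f y) + (\<Sum>k. b *\<^sub>R ?S k g y)"
      by (intro suminf_add[symmetric] summable_scaleR_right sf sg)
    also have "\<dots> = a *\<^sub>R T f y + b *\<^sub>R T g y"
      by (simp add: T_def suminf_scaleR_right sf sg)
    finally show ?case .
  qed
qed

end

subsection \<open>Geometry of Lipschitz domains\<close>

lemma norm_orthogonal_part_le: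
  fixes v e :: "'a::real_inner"
  assumes "norm e = 1"
  shows "norm (v - (v \<bullet> e) *\<^sub>R e) \<le> norm v"
proof -
  have "(norm (v - (v \<bullet> e) *\<^sub>R e))\<^sup>2 = (norm v)\<^sup>2 - (v \<bullet> e)\<^sup>2"
    using assms unfolding power2_norm_eq_inner norm_eq_1
    by (simp add: inner_diff_left inner_diff_right inner_commute power2_eq_square)
  then show ?thesis
    by (metis diff_ge_0_iff_ge diff_le_eq le_add_same_cancel1 norm_ge_zero power2_le_imp_le zero_le_power2)
qed

text \<open>The height \<open>F\<close> above the graph is Lipschitz with constant 1 + L and
  nonnegative at the nearest point outside the domain. So \<open>F x\<close> is at least minus (1 +
  L) times the distance to the complement, while moving by s along e raises \<open>F\<close> by
  exactly s.\<close>

lemma lipschitz_domain_exit: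
  fixes \<Omega> :: "'a::euclidean_space set"
  assumes "lipschitz_domain \<Omega>" "z \<in> frontier \<Omega>"
  shows "\<exists>e \<rho> H M. norm e = 1 \<and> \<rho> > 0 \<and> H > 0 \<and> M > 0 \<and>
    (\<forall>x s. x \<in> ball z \<rho> \<longrightarrow> M * infdist x (- \<Omega>) \<le> s \<longrightarrow> s \<le> H \<longrightarrow> x + s *\<^sub>R e \<notin> \<Omega>)"
proof -
  from assms have "open \<Omega>" by (simp add: lipschitz_domain_def)
  obtain e r h L g where e: "norm e = 1" and r: "r > 0" and h: "h > 0"
    and g: "L-lipschitz_on {y. y \<bullet> e = 0} (g :: 'a \<Rightarrow> real)"
    and graph: "\<And>y. norm ((y - z) - ((y - z) \<bullet> e) *\<^sub>R e) < r \<Longrightarrow> \<bar>(y - z) \<bullet> e\<bar> < h \<Longrightarrow>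
             (y \<in> \<Omega> \<longleftrightarrow> (y - z) \<bullet> e < g ((y - z) - ((y - z) \<bullet> e) *\<^sub>R e))"
    using assms unfolding lipschitz_domain_def by blast
  define P where "P v = v - (v \<bullet> e) *\<^sub>R e" for v
  define F where "F y = (y - z) \<bullet> e - g (P (y - z))" for y
  have ee: "e \<bullet> e = 1" using e by (simp add: norm_eq_1)
  have P_le: "norm (P v) \<le> norm v" for v
    unfolding P_def by (rule norm_orthogonal_part_le[OF e])
  have P_perp: "P v \<bullet> e = 0" for v by (simp add: P_def inner_diff_left ee)
  have P_diff: "P u - P v = P (u - v)" for u v by (simp add: P_def inner_diff_left algebra_simps)
  have P_e: "P (v + s *\<^sub>R e) = P v" for v s by (simp add: P_def inner_add_left ee algebra_simps)
  have L: "L \<ge> 0" using g by (rule lipschitz_on_nonneg)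
  have F_lip: "F w - F x \<le> (1 + L) * norm (x - w)" for x w
  proof -
    have "(w - z) \<bullet> e - (x - z) \<bullet> e = (w - x) \<bullet> e" by (simp add: inner_diff_left)
    also have "\<dots> \<le> norm (x - w)"
      using Cauchy_Schwarz_ineq2[of "w - x" e] e by (simp add: norm_minus_commute)
    finally have 1: "(w - z) \<bullet> e - (x - z) \<bullet> e \<le> norm (x - w)" .
    have "\<bar>g (P (x - z)) - g (P (w - z))\<bar> \<le> L * norm (P (x - z) - P (w - z))"
      using lipschitz_onD[OF g, of "P (x - z)" "P (w - z)"] by (simp add: P_perp dist_norm)
    also have "\<dots> \<le> L * norm (x - w)"
      unfolding P_diff using P_le[of "x - w"] L by (intro mult_left_mono) auto
    finally show ?thesis using 1 by (simp add: F_def algebra_simps)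
  qed
  \<comment> \<open>The exterior point nearest to \<open>x\<close> is within 2 \<rho> of
    \<open>z\<close>, and a shift of \<open>x\<close> by at most h / 2 stays inside the
    cylinder.\<close>
  define \<rho> where "\<rho> = min r h / 4"
  have \<rho>: "\<rho> > 0" "4 * \<rho> \<le> r" "4 * \<rho> \<le> h" using r h by (auto simp: \<rho>_def)
  have cyl: "y \<in> \<Omega> \<longleftrightarrow> F y < 0" if "norm (P (y - z)) < r" "\<bar>(y - z) \<bullet> e\<bar> < h" for y
    using graph[of y] that by (auto simp: F_def P_def)
  have "x + s *\<^sub>R e \<notin> \<Omega>" if x: "x \<in> ball z \<rho>" and s: "(1 + L) * infdist x (- \<Omega>) \<le> s" "s \<le> h / 2" for x s
  proof -
    have z: "z \<in> - \<Omega>" using assms(2) \<open>open \<Omega>\<close> by (simp add: frontier_def interior_open)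
    then obtain w where w: "w \<in> - \<Omega>" "infdist x (- \<Omega>) = dist x w"
      using infdist_attains_inf[of "- \<Omega>" x] \<open>open \<Omega>\<close> by (auto simp: closed_Compl)
    have xz: "norm (x - z) < \<rho>" using x by (simp add: dist_norm norm_minus_commute)
    have "dist x w \<le> dist x z" using infdist_le[OF z, of x] w by simp
    then have "norm (x - w) < \<rho>" using xz by (simp add: dist_norm)
    then have wz: "norm (w - z) < 2 * \<rho>"
      using norm_triangle_ineq[of "w - x" "x - z"] xz by (simp add: norm_minus_commute)
    have e_le: "\<bar>v \<bullet> e\<bar> \<le> norm v" for v
      using Cauchy_Schwarz_ineq2[of v e] e by simp
    have "F w \<ge> 0"
      using cyl[of w] w(1) P_le[of "w - z"] e_le[of "w - z"] wz \<rho> by auto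
    then have "F x \<ge> - s"
      using F_lip[of w x] s w(2) by (simp add: dist_norm)
    have s0: "s \<ge> 0" using s(1) L infdist_nonneg[of x "- \<Omega>"]
      by (meson add_nonneg_nonneg mult_nonneg_nonneg order_trans zero_le_one)
    have eq: "x + s *\<^sub>R e - z = (x - z) + s *\<^sub>R e" by simp
    have 1: "norm (P (x + s *\<^sub>R e - z)) < r"
      unfolding eq P_e using P_le[of "x - z"] xz \<rho> by linarith
    have ve: "(x + s *\<^sub>R e - z) \<bullet> e = (x - z) \<bullet> e + s"
      unfolding eq by (simp add: inner_add_left ee)
    have 2: "\<bar>(x + s *\<^sub>R e - z) \<bullet> e\<bar> < h"
      unfolding ve using e_le[of "x - z"] xz \<rho> s0 s(2) h by linarith
    have "F (x + s *\<^sub>R e) = F x + s"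
      unfolding F_def ve unfolding eq P_e by simp
    then show ?thesis using cyl[OF 1 2] \<open>F x \<ge> - s\<close> by simp
  qed
  then show ?thesis
    using e \<rho>(1) h L
    by (intro exI[of _ e] exI[of _ \<rho>] exI[of _ "h / 2"] exI[of _ "1 + L"]) auto
qed

text \<open>Compactness of the boundary makes the constants uniform. Quarter balls leave room: the
  partition functions will live in the half balls, and points near those still lie in the balls
  where the exit property holds.\<close>

lemma lipschitz_domain_charts:
  fixes \<Omega> :: "'a::euclidean_space set"
  assumes \<Omega>: "lipschitz_domain \<Omega>"
  obtains Z :: "'a set" and e :: "'a \<Rightarrow> 'a" and \<rho> :: "'a \<Rightarrow> real" and H M :: real
  where "finite Z" "H > 0" "M > 0" "\<And>z. z \<in> Z \<Longrightarrow> \<rho> z > 0" "\<And>z. z \<in> Z \<Longrightarrow> norm (e z) = 1"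
    "frontier \<Omega> \<subseteq> (\<Union>z\<in>Z. ball z (\<rho> z / 4))"
    "\<And>z x s. z \<in> Z \<Longrightarrow> x \<in> ball z (\<rho> z) \<Longrightarrow> M * infdist x (- \<Omega>) \<le> s \<Longrightarrow> s \<le> H \<Longrightarrow>
      x + s *\<^sub>R e z \<notin> \<Omega>"
proof -
  have "\<forall>z\<in>frontier \<Omega>. \<exists>e \<rho> H M. norm e = 1 \<and> \<rho> > 0 \<and> H > 0 \<and> M > 0 \<and>
    (\<forall>x s. x \<in> ball z \<rho> \<longrightarrow> M * infdist x (- \<Omega>) \<le> s \<longrightarrow> s \<le> H \<longrightarrow> x + s *\<^sub>R e \<notin> \<Omega>)"
    using lipschitz_domain_exit[OF \<Omega>] by blast
  then obtain e \<rho> H M where ch: "\<And>z. z \<in> frontier \<Omega> \<Longrightarrow> norm (e z :: 'a) = 1 \<and> \<rho> z > 0 \<and> H z > 0 \<and> M z > 0 \<and>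
    (\<forall>x s. x \<in> ball z (\<rho> z) \<longrightarrow> M z * infdist x (- \<Omega>) \<le> s \<longrightarrow> s \<le> (H z :: real) \<longrightarrow> x + s *\<^sub>R e z \<notin> \<Omega>)"
    by (simp only: bchoice_iff) blast
  have "bounded \<Omega>" using \<Omega> by (simp add: lipschitz_domain_def)
  then have cpt: "compact (frontier \<Omega>)" by (rule compact_frontier_bounded)
  have cov: "frontier \<Omega> \<subseteq> (\<Union>z\<in>frontier \<Omega>. ball z (\<rho> z / 4))"
    using ch by force
  obtain Z where Z: "Z \<subseteq> frontier \<Omega>" "finite Z" "frontier \<Omega> \<subseteq> (\<Union>z\<in>Z. ball z (\<rho> z / 4))"
    by (rule compactE_image[OF cpt _ cov]) auto
  \<comment> \<open>The inserted 1 keeps the set nonempty when \<open>Z\<close> is empty, as for the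
    empty domain.\<close>
  define H0 where "H0 = Min (insert 1 (H ` Z))"
  define M0 where "M0 = Max (insert 1 (M ` Z))"
  have H0: "H0 > 0" "\<And>z. z \<in> Z \<Longrightarrow> H0 \<le> H z"
    using Z ch by (auto simp: H0_def)
  have M0: "M0 > 0" "\<And>z. z \<in> Z \<Longrightarrow> M z \<le> M0"
    using Z ch by (auto simp: M0_def Max_gr_iff)
  show thesis
  proof (rule that[of Z H0 M0 \<rho> e])
    fix z x s assume *: "z \<in> Z" "x \<in> ball z (\<rho> z)" "M0 * infdist x (- \<Omega>) \<le> s" "s \<le> H0"
    have "M z * infdist x (- \<Omega>) \<le> M0 * infdist x (- \<Omega>)"
      using M0(2)[OF *(1)] by (intro mult_right_mono) (auto simp: infdist_nonneg)
    with * H0(2)[OF *(1)] ch[of z] Z(1) show "x + s *\<^sub>R e z \<notin> \<Omega>"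
      by (meson order_trans subsetD)
  qed (use Z ch H0 M0 in auto)
qed

text \<open>Each newly added function keeps the whole of \<open>b j\<close>, and those already
  present are scaled by \<open>1 - b j\<close>. The product formula shows that the sum is exactly 1
  wherever some \<open>b i\<close> equals 1.\<close>

lemma smooth_partition:
  fixes b :: "'i \<Rightarrow> 'a::euclidean_space \<Rightarrow> real"
  assumes "finite I" "\<And>i. i \<in> I \<Longrightarrow> smooth_fun (b i)"
    "\<And>i x. i \<in> I \<Longrightarrow> 0 \<le> b i x" "\<And>i x. i \<in> I \<Longrightarrow> b i x \<le> 1"
  shows "\<exists>\<theta>. (\<forall>i\<in>I. smooth_fun (\<theta> i) \<and> (\<forall>x. 0 \<le> \<theta> i x \<and> (\<theta> i x \<noteq> 0 \<longrightarrow> b i x \<noteq> 0))) \<and>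
    (\<forall>x. (\<Sum>i\<in>I. \<theta> i x) = 1 - (\<Prod>i\<in>I. 1 - b i x))"
  using assms
proof (induction I rule: finite_induct)
  case (insert j I)
  have "\<exists>\<theta>. (\<forall>i\<in>I. smooth_fun (\<theta> i) \<and> (\<forall>x. 0 \<le> \<theta> i x \<and> (\<theta> i x \<noteq> 0 \<longrightarrow> b i x \<noteq> 0))) \<and>
    (\<forall>x. (\<Sum>i\<in>I. \<theta> i x) = 1 - (\<Prod>i\<in>I. 1 - b i x))"
    using insert.prems by (intro insert.IH) auto
  then obtain \<theta> where \<theta>: "\<forall>i\<in>I. smooth_fun (\<theta> i) \<and> (\<forall>x. 0 \<le> \<theta> i x \<and> (\<theta> i x \<noteq> 0 \<longrightarrow> b i x \<noteq> 0))"
    and \<theta>_sum: "\<And>x. (\<Sum>i\<in>I. \<theta> i x) = 1 - (\<Prod>i\<in>I. 1 - b i x)"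
    by blast
  define \<theta>' where "\<theta>' i = (if i = j then b j else (\<lambda>x. \<theta> i x * (1 - b j x)))" for i
  have "(\<Sum>i\<in>insert j I. \<theta>' i x) = 1 - (\<Prod>i\<in>insert j I. 1 - b i x)" for x
  proof -
    have "(\<Sum>i\<in>I. \<theta>' i x) = (\<Sum>i\<in>I. \<theta> i x) * (1 - b j x)"
      unfolding sum_distrib_right using insert.hyps by (intro sum.cong) (auto simp: \<theta>'_def)
    then show ?thesis
      using insert.hyps by (simp add: \<theta>_sum \<theta>'_def algebra_simps)
  qed
  moreover have "smooth_fun (\<theta>' i) \<and> (\<forall>x. 0 \<le> \<theta>' i x \<and> (\<theta>' i x \<noteq> 0 \<longrightarrow> b i x \<noteq> 0))" if "i \<in> insert j I" for i
    using that insert.prems \<theta> by (auto simp: \<theta>'_def intro!: smooth_intros)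
  ultimately show ?case by blast
qed auto

text \<open>The interface between geometry and operator. \<open>\<psi>_step\<close> separates the
  transition layers of the cutoffs. \<open>exit_near\<close> covers the whole range of shifts from H
  / 2 ^ k to H, because segments of shifts occur besides single ones; \<open>exit_far\<close>
  concerns only the largest shift, which produces the boundary term at the innermost layer.\<close>

locale collar =
  fixes \<Omega> \<Omega>' :: "'a::euclidean_space set" and Z :: "'a set" and e :: "'a \<Rightarrow> 'a"
    and \<theta> :: "'a \<Rightarrow> 'a \<Rightarrow> real" and \<psi> :: "nat \<Rightarrow> 'a \<Rightarrow> real" and H X D :: real
  assumes open_dom: "open \<Omega>"
    and finite_Z: "finite Z"
    and H_pos: "H > 0"
    and norm_e: "\<And>z. z \<in> Z \<Longrightarrow> norm (e z) = 1"
    and smooth_\<theta>: "\<And>z. z \<in> Z \<Longrightarrow> smooth_fun (\<theta> z)"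
    and \<theta>_nonneg: "\<And>z x. z \<in> Z \<Longrightarrow> 0 \<le> \<theta> z x"
    and sum_\<theta>_le: "\<And>x. (\<Sum>z\<in>Z. \<theta> z x) \<le> 1"
    and norm_grad_\<theta>: "\<And>z x. z \<in> Z \<Longrightarrow> norm (grad (\<theta> z) x) \<le> X"
    and smooth_\<psi>: "\<And>k. smooth_fun (\<psi> k)"
    and \<psi>_nonneg: "\<And>k x. 0 \<le> \<psi> k x"
    and \<psi>_le: "\<And>k x. \<psi> k x \<le> 1"
    and \<psi>_step: "\<And>k x. \<psi> k x \<noteq> 0 \<Longrightarrow> \<psi> (Suc k) x = 1"
    and \<psi>_support: "\<And>k. \<exists>S. compact S \<and> S \<subseteq> \<Omega> \<and> (\<forall>x. \<psi> k x \<noteq> 0 \<longrightarrow> x \<in> S)"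
    and \<psi>_exhausts: "\<And>x. x \<in> \<Omega> \<Longrightarrow> \<exists>k. \<psi> k x = 1"
    and norm_grad_\<psi>: "\<And>k x. norm (grad (\<psi> k) x) \<le> D * 2 ^ k"
    and sum_\<theta>_eq: "\<And>x. x \<in> \<Omega> \<Longrightarrow> \<psi> 0 x \<noteq> 1 \<Longrightarrow> (\<Sum>z\<in>Z. \<theta> z x) = 1"
    and exit_near: "\<And>z x k s. z \<in> Z \<Longrightarrow> x \<in> \<Omega> \<Longrightarrow> \<theta> z x \<noteq> 0 \<Longrightarrow> \<psi> k x \<noteq> 1 \<Longrightarrow>
      H / 2 ^ k \<le> s \<Longrightarrow> s \<le> H \<Longrightarrow> x + s *\<^sub>R e z \<notin> \<Omega>"
    and exit_far: "\<And>z x. z \<in> Z \<Longrightarrow> x \<in> \<Omega> \<Longrightarrow> \<theta> z x \<noteq> 0 \<Longrightarrow> \<psi> 0 x \<noteq> 1 \<Longrightarrow>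
      x + H *\<^sub>R e z \<notin> \<Omega>'"

text \<open>Depth is the distance to the complement: \<open>\<psi> k\<close> passes from 0 to 1
  between the depths a / 2 ^ (k + 1) and a / 2 ^ k, so different transitions do not overlap.
  \<open>\<Omega>'\<close> is the neighbourhood of \<Omega> of width \<eta>.\<close>

lemma lipschitz_domain_collar:
  fixes \<Omega> :: "'a::euclidean_space set"
  assumes \<Omega>: "lipschitz_domain \<Omega>"
  shows "\<exists>\<Omega>' Z e \<theta> \<psi> H X D. open \<Omega>' \<and> closure \<Omega> \<subseteq> \<Omega>' \<and> collar \<Omega> \<Omega>' Z e \<theta> \<psi> H X D"
proof -
  have op: "open \<Omega>" and bd: "bounded \<Omega>" using \<Omega> by (auto simp: lipschitz_domain_def)
  obtain Z :: "'a set" and e :: "'a \<Rightarrow> 'a" and \<rho> :: "'a \<Rightarrow> real" and H M :: real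
    where Z: "finite Z" and H: "H > 0" and M: "M > 0" and \<rho>: "\<And>z. z \<in> Z \<Longrightarrow> \<rho> z > 0"
    and e: "\<And>z. z \<in> Z \<Longrightarrow> norm (e z) = 1"
    and cover: "frontier \<Omega> \<subseteq> (\<Union>z\<in>Z. ball z (\<rho> z / 4))"
    and ex: "\<And>z x s. z \<in> Z \<Longrightarrow> x \<in> ball z (\<rho> z) \<Longrightarrow> M * infdist x (- \<Omega>) \<le> s \<Longrightarrow> s \<le> H \<Longrightarrow>
      x + s *\<^sub>R e z \<notin> \<Omega>"
    by (rule lipschitz_domain_charts[OF \<Omega>]) (rule that; assumption)
  obtain C :: real where C: "C > 0" and cutoff:
    "\<And>\<epsilon> S. \<epsilon> > 0 \<Longrightarrow> bounded (S :: 'a set) \<Longrightarrow>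
      \<exists>\<psi>. smooth_fun \<psi> \<and> (\<forall>x. 0 \<le> \<psi> x \<and> \<psi> x \<le> 1) \<and> (\<forall>x\<in>S. \<psi> x = 1) \<and>
        (\<forall>x. \<psi> x \<noteq> 0 \<longrightarrow> (\<exists>y\<in>S. dist x y < \<epsilon>)) \<and> (\<forall>x. norm (grad \<psi> x) \<le> C / \<epsilon>)"
    using smooth_cutoff_exists by blast
  let ?d = "\<lambda>x. infdist x (- \<Omega>)"
  have ne: "- \<Omega> \<noteq> {}"
  proof
    assume "- \<Omega> = {}"
    then have "\<Omega> = UNIV" by blast
    with bd show False using not_bounded_UNIV by simp
  qed
  have d_lip: "?d x \<le> ?d y + dist x y" for x y
    by (rule infdist_triangle)
  have d_pos: "?d x > 0 \<longleftrightarrow> x \<in> \<Omega>" for x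
    using in_closed_iff_infdist_zero[of "- \<Omega>" x] op ne infdist_nonneg[of x "- \<Omega>"] by (auto simp: closed_Compl less_le)
  have "\<forall>z\<in>Z. \<exists>b. smooth_fun b \<and> (\<forall>x. 0 \<le> b x \<and> b x \<le> 1) \<and> (\<forall>x\<in>ball z (\<rho> z / 4). b x = 1) \<and>
      (\<forall>x. b x \<noteq> 0 \<longrightarrow> x \<in> ball z (\<rho> z / 2))"
  proof
    fix z assume "z \<in> Z"
    then obtain b where b: "smooth_fun b" "\<forall>x. 0 \<le> b x \<and> b x \<le> 1" "\<forall>x\<in>ball z (\<rho> z / 4). b x = 1"
      "\<forall>x. b x \<noteq> 0 \<longrightarrow> (\<exists>y\<in>ball z (\<rho> z / 4). dist x y < \<rho> z / 4)"
      using cutoff[of "\<rho> z / 4" "ball z (\<rho> z / 4)"] \<rho> by auto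
    have "x \<in> ball z (\<rho> z / 2)" if bx: "b x \<noteq> 0" for x
    proof -
      obtain y where "dist z y < \<rho> z / 4" "dist x y < \<rho> z / 4" using b(4) bx by auto
      then show ?thesis using dist_triangle[of z x y] by (simp add: dist_commute)
    qed
    with b show "\<exists>b. smooth_fun b \<and> (\<forall>x. 0 \<le> b x \<and> b x \<le> 1) \<and> (\<forall>x\<in>ball z (\<rho> z / 4). b x = 1) \<and>
      (\<forall>x. b x \<noteq> 0 \<longrightarrow> x \<in> ball z (\<rho> z / 2))" by blast
  qed
  then obtain b where b: "\<And>z. z \<in> Z \<Longrightarrow> smooth_fun (b z)" "\<And>z x. z \<in> Z \<Longrightarrow> 0 \<le> b z x"
    "\<And>z x. z \<in> Z \<Longrightarrow> b z x \<le> 1" "\<And>z x. z \<in> Z \<Longrightarrow> x \<in> ball z (\<rho> z / 4) \<Longrightarrow> b z x = 1"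
    "\<And>z x. z \<in> Z \<Longrightarrow> b z x \<noteq> 0 \<Longrightarrow> x \<in> ball z (\<rho> z / 2)"
    unfolding bchoice_iff by blast
  have "\<exists>\<theta>. (\<forall>z\<in>Z. smooth_fun (\<theta> z) \<and> (\<forall>x. 0 \<le> \<theta> z x \<and> (\<theta> z x \<noteq> 0 \<longrightarrow> b z x \<noteq> 0))) \<and>
    (\<forall>x. (\<Sum>z\<in>Z. \<theta> z x) = 1 - (\<Prod>z\<in>Z. 1 - b z x))"
    by (rule smooth_partition) (use Z b in auto)
  then obtain \<theta> where \<theta>': "\<And>z. z \<in> Z \<Longrightarrow> smooth_fun (\<theta> z)" "\<And>z x. z \<in> Z \<Longrightarrow> 0 \<le> \<theta> z x"
    "\<And>z x. z \<in> Z \<Longrightarrow> \<theta> z x \<noteq> 0 \<Longrightarrow> b z x \<noteq> 0"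
    "\<And>x. (\<Sum>z\<in>Z. \<theta> z x) = 1 - (\<Prod>z\<in>Z. 1 - b z x)"
    by blast
  have \<theta>_supp: "\<And>z x. z \<in> Z \<Longrightarrow> \<theta> z x \<noteq> 0 \<Longrightarrow> x \<in> ball z (\<rho> z / 2)"
    using b(5) \<theta>'(3) by blast
  note \<theta> = \<theta>'(1,2) \<theta>_supp \<theta>'(4)
  have "\<forall>z\<in>Z. \<exists>B. \<forall>x. norm (grad (\<theta> z) x) \<le> B"
  proof
    fix z assume z: "z \<in> Z"
    have "\<theta> z x = 0" if "x \<notin> cball z (\<rho> z / 2)" for x
      using \<theta>(3)[OF z, of x] that by auto
    then show "\<exists>B. \<forall>x. norm (grad (\<theta> z) x) \<le> B"
      using smooth_compact_support_grad_bounded[OF \<theta>(1)[OF z] compact_cball] by metis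
  qed
  then obtain B where B: "\<And>z x. z \<in> Z \<Longrightarrow> norm (grad (\<theta> z) x) \<le> B z"
    unfolding bchoice_iff by blast
  define X where "X = (\<Sum>z\<in>Z. \<bar>B z\<bar>)"
  have X: "norm (grad (\<theta> z) x) \<le> X" if "z \<in> Z" for z x
  proof -
    have "B z \<le> \<bar>B z\<bar>" by simp
    also have "\<dots> \<le> X" unfolding X_def using Z that by (intro member_le_sum) auto
    finally show ?thesis using B[OF that, of x] by simp
  qed
  \<comment> \<open>The part of the closure not covered by the quarter balls is compact and disjoint
    from the complement of \<Omega>, hence at a positive distance \<delta> from it. Points of
    smaller depth are therefore covered.\<close>
  let ?U = "\<Union>z\<in>Z. ball z (\<rho> z / 4)"
  obtain \<delta> where \<delta>: "\<delta> > 0" "\<And>x. x \<in> \<Omega> \<Longrightarrow> ?d x < \<delta> \<Longrightarrow> x \<in> ?U"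
  proof -
    have "compact (closure \<Omega> - ?U)"
      using bd by (intro compact_diff open_UN ballI open_ball) (simp add: compact_closure)
    moreover have "(closure \<Omega> - ?U) \<inter> - \<Omega> = {}"
      using cover op by (auto simp: frontier_def interior_open)
    ultimately obtain \<delta> where \<delta>: "\<delta> > 0" "\<forall>x\<in>closure \<Omega> - ?U. \<forall>y\<in>- \<Omega>. \<delta> \<le> dist x y"
      using separate_compact_closed[of "closure \<Omega> - ?U" "- \<Omega>"] op by (auto simp: closed_Compl)
    have "x \<in> ?U" if x: "x \<in> \<Omega>" "?d x < \<delta>" for x
    proof (rule ccontr)
      assume "x \<notin> ?U"
      then have "x \<in> closure \<Omega> - ?U" using x(1) closure_subset by blast
      then have "\<delta> \<le> ?d x"
        using \<delta>(2) ne by (auto simp: infdist_def intro!: cINF_greatest)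
      with x(2) show False by simp
    qed
    with \<delta>(1) show thesis using that by blast
  qed
  \<comment> \<open>The bound by \<delta> puts all layers in the covered strip. The bound on M a
    keeps half of \<open>H\<close> in reserve for the thickness of \<open>\<Omega>'\<close>: M (a +
    \<eta>) \<le> H.\<close>
  define a where "a = min \<delta> (H / (2 * M))"
  have a: "a > 0" "a \<le> \<delta>" "M * a \<le> H / 2"
    using \<delta> H M by (auto simp: a_def min_def field_simps)
  have "\<forall>k. \<exists>\<psi>. smooth_fun \<psi> \<and> (\<forall>x. 0 \<le> \<psi> x \<and> \<psi> x \<le> 1) \<and> (\<forall>x. ?d x \<ge> a / 2 ^ k \<longrightarrow> \<psi> x = 1) \<and>
    (\<forall>x. \<psi> x \<noteq> 0 \<longrightarrow> ?d x > a / 2 ^ Suc k) \<and> (\<forall>x. norm (grad \<psi> x) \<le> (2 * C / a) * 2 ^ k)"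
  proof
    fix k
    have ak: "a / 2 ^ k > 0" "a / 2 ^ Suc k > 0" using a by auto
    have "{x. ?d x \<ge> a / 2 ^ k} \<subseteq> \<Omega>" using ak d_pos by force
    then have "bounded {x. ?d x \<ge> a / 2 ^ k}" using bd bounded_subset by blast
    \<comment> \<open>The cutoff radius is half the depth, so the support stays deeper than a / 2 ^
      (k + 1), and C divided by this radius is (2 C / a) 2 ^ k.\<close>
    note cutoff[OF ak(2) this]
    then obtain \<psi> where \<psi>: "smooth_fun \<psi>" "\<forall>x. 0 \<le> \<psi> x \<and> \<psi> x \<le> 1" "\<forall>x\<in>{x. ?d x \<ge> a / 2 ^ k}. \<psi> x = 1"
        "\<forall>x. \<psi> x \<noteq> 0 \<longrightarrow> (\<exists>y\<in>{x. ?d x \<ge> a / 2 ^ k}. dist x y < a / 2 ^ Suc k)"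
        "\<forall>x. norm (grad \<psi> x) \<le> C / (a / 2 ^ Suc k)"
      by (elim exE conjE) (rule that; assumption)
    have "?d x > a / 2 ^ Suc k" if px: "\<psi> x \<noteq> 0" for x
    proof -
      obtain y where y: "?d y \<ge> a / 2 ^ k" "dist x y < a / 2 ^ Suc k" using \<psi>(4) px by auto
      moreover have "a / 2 ^ k = 2 * (a / 2 ^ Suc k)" by simp
      ultimately show ?thesis using d_lip[of y x] by (simp only: dist_commute)
    qed
    moreover have "norm (grad \<psi> x) \<le> (2 * C / a) * 2 ^ k" for x
      using spec[OF \<psi>(5), of x] by (simp add: field_simps)
    ultimately show "\<exists>\<psi>. smooth_fun \<psi> \<and> (\<forall>x. 0 \<le> \<psi> x \<and> \<psi> x \<le> 1) \<and> (\<forall>x. ?d x \<ge> a / 2 ^ k \<longrightarrow> \<psi> x = 1) \<and>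
    (\<forall>x. \<psi> x \<noteq> 0 \<longrightarrow> ?d x > a / 2 ^ Suc k) \<and> (\<forall>x. norm (grad \<psi> x) \<le> (2 * C / a) * 2 ^ k)"
      using \<psi>(1-3) by (intro exI[of _ \<psi>]) auto
  qed
  then obtain \<psi> where \<psi>: "\<And>k. smooth_fun (\<psi> k)" "\<And>k x. 0 \<le> \<psi> k x" "\<And>k x. \<psi> k x \<le> 1"
    "\<And>k x. ?d x \<ge> a / 2 ^ k \<Longrightarrow> \<psi> k x = 1" "\<And>k x. \<psi> k x \<noteq> 0 \<Longrightarrow> ?d x > a / 2 ^ Suc k"
    "\<And>k x. norm (grad (\<psi> k) x) \<le> (2 * C / a) * 2 ^ k"
    unfolding choice_iff by blast
  \<comment> \<open>The half radii ensure that moving a point of a half ball by less than \<eta>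
    keeps it in the ball of that chart.\<close>
  define \<eta> where "\<eta> = Min (insert (H / (2 * M)) ((\<lambda>z. \<rho> z / 2) ` Z))"
  have "\<eta> > 0" using Z H M \<rho> by (simp add: \<eta>_def)
  moreover have "\<eta> \<le> H / (2 * M)" "\<And>z. z \<in> Z \<Longrightarrow> \<eta> \<le> \<rho> z / 2"
    unfolding \<eta>_def by (rule Min_le; use Z in blast)+
  ultimately have \<eta>: "\<eta> > 0" "\<eta> \<le> H / (2 * M)" "\<And>z. z \<in> Z \<Longrightarrow> \<eta> \<le> \<rho> z / 2"
    by blast+
  define \<Omega>' where "\<Omega>' = (\<Union>x\<in>\<Omega>. ball x \<eta>)"
  have "closure \<Omega> \<subseteq> \<Omega>'"
  proof
    fix x assume "x \<in> closure \<Omega>"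
    then obtain y where "y \<in> \<Omega>" "dist y x < \<eta>" using \<eta>(1) closure_approachable by blast
    then show "x \<in> \<Omega>'" by (auto simp: \<Omega>'_def)
  qed
  moreover have "open \<Omega>'" by (auto simp: \<Omega>'_def)
  moreover have "collar \<Omega> \<Omega>' Z e \<theta> \<psi> H X (2 * C / a)"
  proof
    show "(\<Sum>z\<in>Z. \<theta> z x) \<le> 1" for x
      unfolding \<theta>(4) using b by (simp add: prod_nonneg)
    show "\<psi> (Suc k) x = 1" if "\<psi> k x \<noteq> 0" for k x
      using \<psi>(5)[OF that] by (intro \<psi>(4)) simp
    show "\<exists>S. compact S \<and> S \<subseteq> \<Omega> \<and> (\<forall>x. \<psi> k x \<noteq> 0 \<longrightarrow> x \<in> S)" for k
    proof (intro exI[of _ "{x. ?d x \<ge> a / 2 ^ Suc k}"] conjI allI impI)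
      have "a / 2 ^ Suc k > 0" using a by simp
      then show sub: "{x. ?d x \<ge> a / 2 ^ Suc k} \<subseteq> \<Omega>" using d_pos by force
      have "closed {x. ?d x \<ge> a / 2 ^ Suc k}"
        by (intro closed_Collect_le continuous_intros)
      then show "compact {x. ?d x \<ge> a / 2 ^ Suc k}"
        using bounded_subset[OF bd sub] by (simp add: compact_eq_bounded_closed)
    qed (use \<psi>(5) less_imp_le in blast)
    show "\<exists>k. \<psi> k x = 1" if "x \<in> \<Omega>" for x
    proof -
      have "?d x > 0" using d_pos that by simp
      then obtain k where "a / ?d x < 2 ^ k" using real_arch_pow[of 2 "a / ?d x"] by auto
      then have "a / 2 ^ k \<le> ?d x" using \<open>?d x > 0\<close> by (simp add: field_simps)
      then show ?thesis using \<psi>(4) by blast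
    qed
    have lt: "?d x < a / 2 ^ k" if "\<psi> k x \<noteq> 1" for k x
      using \<psi>(4)[of k x] that by force
    show "(\<Sum>z\<in>Z. \<theta> z x) = 1" if "x \<in> \<Omega>" "\<psi> 0 x \<noteq> 1" for x
    proof -
      have "x \<in> ?U" using \<delta>(2)[OF that(1)] lt[OF that(2)] a by simp
      then obtain z where "z \<in> Z" "b z x = 1" using b(4) by blast
      then have "(\<Prod>z\<in>Z. 1 - b z x) = 0" using Z by (intro prod_zero) auto
      then show ?thesis by (simp add: \<theta>(4))
    qed
    show "x + s *\<^sub>R e z \<notin> \<Omega>" if "z \<in> Z" "\<theta> z x \<noteq> 0" "\<psi> k x \<noteq> 1" "H / 2 ^ k \<le> s" "s \<le> H" for z x k s
    proof (rule ex[OF that(1) _ _ that(5)])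
      show "x \<in> ball z (\<rho> z)" using \<theta>(3)[OF that(1,2)] \<rho>[OF that(1)] by simp
      have "M * ?d x \<le> M * (a / 2 ^ k)" using lt[OF that(3)] M by (intro mult_left_mono) auto
      also have "\<dots> \<le> H / 2 ^ k" using a(3) H by (simp add: divide_right_mono)
      finally show "M * ?d x \<le> s" using that(4) by simp
    qed
    show "x + H *\<^sub>R e z \<notin> \<Omega>'" if "z \<in> Z" "\<theta> z x \<noteq> 0" "\<psi> 0 x \<noteq> 1" for z x
    proof
      assume "x + H *\<^sub>R e z \<in> \<Omega>'"
      then obtain w where w: "w \<in> \<Omega>" "dist w (x + H *\<^sub>R e z) < \<eta>" by (auto simp: \<Omega>'_def)
      \<comment> \<open>Shifting \<open>w\<close> back lands within \<eta> of \<open>x\<close>,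
        hence in the same chart at depth at most a + \<eta>; from there the shift by
        \<open>H\<close> must leave \<Omega>, contrary to the choice of \<open>w\<close>.\<close>
      define y where "y = w - H *\<^sub>R e z"
      have dy: "dist y x < \<eta>" using w(2) by (simp add: y_def dist_norm algebra_simps)
      have "y + H *\<^sub>R e z \<notin> \<Omega>"
      proof (rule ex[OF that(1)])
        show "y \<in> ball z (\<rho> z)"
          using \<theta>(3)[OF that(1,2)] \<eta>(3)[OF that(1)] dy dist_triangle[of z y x] by (simp add: dist_commute)
        have "?d y \<le> a + \<eta>" using d_lip[of y x] dy lt[OF that(3)] by simp
        then have "M * ?d y \<le> M * (a + \<eta>)" using M by simp
        also have "\<dots> \<le> H" using a(3) \<eta>(2) M by (simp add: field_simps)
        finally show "M * ?d y \<le> H" .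
      qed simp
      with w(1) show False by (simp add: y_def)
    qed
  qed (use op Z H e \<theta> X \<psi> in auto)
  ultimately show ?thesis by blast
qed

subsection \<open>The extension operator\<close>

lemma sum_inverse_power2_le: "(\<Sum>k<n. 1 / 2 ^ k :: real) \<le> 2"
proof -
  have "(\<Sum>k<n. 1 / 2 ^ k :: real) = 2 - 2 / 2 ^ n"
    by (induction n) (auto simp: field_simps)
  then show ?thesis by simp
qed

text \<open>Abel summation, used with gradients of order 2 ^ k as \<open>g k\<close> and values of
  the test function at the k-th shift as \<open>c k\<close>: differencing moves onto the factor that
  gains from it.\<close>

lemma sum_by_parts:
  fixes g :: "nat \<Rightarrow> 'a::real_vector"
  shows "(\<Sum>k<n. c k *\<^sub>R (g k - g (Suc k)))
    = c 0 *\<^sub>R g 0 - c n *\<^sub>R g n + (\<Sum>k<n. (c (Suc k) - c k) *\<^sub>R g (Suc k))"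
  by (induction n) (auto simp: algebra_simps)

text \<open>Fubini and translation invariance are used for Borel functions over
  \<open>lborel\<close>; this is the passage from Lebesgue measurable fields, carried out in
  coordinates.\<close>

lemma integrable_completion_representative:
  fixes g :: "'b \<Rightarrow> 'a::euclidean_space"
  assumes g: "integrable (completion M) g"
  shows "\<exists>f. integrable M f \<and> (AE x in M. f x = g x)"
proof -
  have "\<forall>b\<in>Basis. \<exists>g'\<in>borel_measurable M. (AE x in M. g x \<bullet> b = g' x)"
    using g by (intro ballI completion_ex_borel_measurable_real) auto
  then obtain g' where g': "\<And>b. b \<in> Basis \<Longrightarrow> g' b \<in> borel_measurable M"
    "\<And>b. b \<in> Basis \<Longrightarrow> (AE x in M. g x \<bullet> b = g' b x)"
    by metis
  define f where "f x = (\<Sum>b\<in>Basis. g' b x *\<^sub>R b)" for x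
  have f: "f \<in> borel_measurable M"
    unfolding f_def[abs_def] using g' by (intro borel_measurable_sum borel_measurable_scaleR) auto
  have "AE x in M. \<forall>b\<in>Basis. g x \<bullet> b = g' b x"
    using g' by (intro AE_finite_allI) auto
  then have eq: "AE x in M. f x = g x"
  proof eventually_elim
    case (elim x)
    then have "f x = (\<Sum>b\<in>Basis. (g x \<bullet> b) *\<^sub>R b)" by (simp add: f_def)
    then show ?case by (simp add: euclidean_representation)
  qed
  have "integrable (completion M) f"
  proof (rule integrable_cong_AE_imp[OF g])
    show "f \<in> borel_measurable (completion M)" using f by (rule measurable_completion)
    show "AE x in completion M. g x = f x"
      using AE_completion[OF eq] by eventually_elim simp
  qed
  then have "integrable M f" using integrable_completion[OF f] by simp
  with eq show ?thesis by blast
qed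

context collar
begin

definition h :: "nat \<Rightarrow> real" where "h k = H / 2 ^ k"
text \<open>The functions \<open>w z k\<close> cut off to the part of the layer \<open>\<psi> k < 1\<close> lying in chart \<open>z\<close>;
  for fixed \<open>z\<close> their differences \<open>p z k\<close> weight the translations by \<open>h k *\<^sub>R e z\<close>.\<close>
definition w :: "'a \<Rightarrow> nat \<Rightarrow> 'a \<Rightarrow> real" where "w z k x = \<theta> z x * (1 - \<psi> k x)"
definition p :: "'a \<Rightarrow> nat \<Rightarrow> 'a \<Rightarrow> real" where "p z k x = \<theta> z x * (\<psi> (Suc k) x - \<psi> k x)"

lemma h_pos: "h k > 0" and h_Suc: "h k = 2 * h (Suc k)" and h_0: "h 0 = H" and h_le: "h k \<le> H"
  using H_pos by (auto simp: h_def field_simps)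

lemma \<theta>_le_1: "z \<in> Z \<Longrightarrow> \<theta> z x \<le> 1"
  using member_le_sum[of z Z "\<lambda>z. \<theta> z x"] finite_Z \<theta>_nonneg sum_\<theta>_le[of x] by force

lemma \<psi>_mono: "\<psi> k x \<le> \<psi> (Suc k) x"
  using \<psi>_step[of k x] \<psi>_le[of k x] \<psi>_nonneg[of "Suc k" x] by (cases "\<psi> k x = 0") auto

lemma \<psi>_later: "\<psi> k x \<noteq> 0 \<Longrightarrow> k < j \<Longrightarrow> \<psi> j x = 1"
proof (induction j)
  case (Suc j)
  then have "\<psi> j x \<noteq> 0" by (cases "k = j") auto
  then show ?case by (rule \<psi>_step)
qed simp

lemma \<psi>_eq_1_later: "\<psi> k x = 1 \<Longrightarrow> k \<le> j \<Longrightarrow> \<psi> j x = 1"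
  using \<psi>_later[of k x j] by (cases "k = j") auto

lemma p_eq: "p z k x = w z k x - w z (Suc k) x"
  by (simp add: p_def w_def algebra_simps)

lemma p_nonneg: "z \<in> Z \<Longrightarrow> 0 \<le> p z k x"
  using \<psi>_mono[of k x] \<theta>_nonneg[of z x] by (simp add: p_def)

lemma sum_p_le: "z \<in> Z \<Longrightarrow> (\<Sum>k<n. p z k x) \<le> 1"
proof -
  assume z: "z \<in> Z"
  have "(\<Sum>k<n. p z k x) = \<theta> z x * (\<psi> n x - \<psi> 0 x)"
    unfolding p_def sum_distrib_left[symmetric] by (simp only: sum_lessThan_telescope[of "\<lambda>k. \<psi> k x" n])
  also have "\<dots> \<le> \<theta> z x * 1"
    using \<psi>_le[of n x] \<psi>_nonneg[of 0 x] by (intro mult_left_mono \<theta>_nonneg z) auto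
  also have "\<dots> \<le> 1" using \<theta>_le_1[OF z] by simp
  finally show ?thesis .
qed

lemma smooth_w: "z \<in> Z \<Longrightarrow> smooth_fun (w z k)"
  unfolding w_def[abs_def] by (intro smooth_intros smooth_\<theta> smooth_\<psi>)

lemma smooth_p: "z \<in> Z \<Longrightarrow> smooth_fun (p z k)"
  unfolding p_def[abs_def] by (intro smooth_intros smooth_\<theta> smooth_\<psi>)

lemma grad_p: "z \<in> Z \<Longrightarrow> grad (p z k) x = grad (w z k) x - grad (w z (Suc k)) x"
  unfolding p_eq[abs_def] by (intro grad_diff smooth_w)

lemma grad_w_eq_0: "z \<in> Z \<Longrightarrow> w z k x = 0 \<Longrightarrow> grad (w z k) x = 0"
  using \<theta>_nonneg \<psi>_le by (intro grad_local_min smooth_w) (auto simp: w_def[of z k _])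

lemma grad_\<psi>_eq_0: "\<psi> k x = 0 \<or> \<psi> k x = 1 \<Longrightarrow> grad (\<psi> k) x = 0"
proof (elim disjE)
  assume "\<psi> k x = 0"
  then show ?thesis by (intro grad_local_min smooth_\<psi>) (simp add: \<psi>_nonneg)
next
  assume 1: "\<psi> k x = 1"
  have "grad (\<lambda>x. 1 - \<psi> k x) x = 0"
    by (intro grad_local_min smooth_intros smooth_\<psi>) (simp add: 1 \<psi>_le)
  then show ?thesis
    by (simp add: grad_diff smooth_const smooth_\<psi> grad_const)
qed

lemma D_nonneg: "D \<ge> 0"
  using order_trans[OF norm_ge_zero norm_grad_\<psi>[of 0 0]] by simp

lemma norm_grad_w: "z \<in> Z \<Longrightarrow> norm (grad (w z k) x) \<le> X + norm (grad (\<psi> k) x)"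
proof -
  assume z: "z \<in> Z"
  have "grad (w z k) x = (1 - \<psi> k x) *\<^sub>R grad (\<theta> z) x - \<theta> z x *\<^sub>R grad (\<psi> k) x"
    unfolding w_def[abs_def]
    by (simp add: grad_mult grad_diff smooth_intros smooth_\<theta>[OF z] smooth_\<psi> grad_const)
  also have "norm \<dots> \<le> norm ((1 - \<psi> k x) *\<^sub>R grad (\<theta> z) x) + norm (\<theta> z x *\<^sub>R grad (\<psi> k) x)"
    by (rule norm_triangle_ineq4)
  also have "\<dots> \<le> norm (grad (\<theta> z) x) + norm (grad (\<psi> k) x)"
    using \<theta>_nonneg[OF z, of x] \<theta>_le_1[OF z, of x] \<psi>_le[of k x] \<psi>_nonneg[of k x]
    by (auto intro!: add_mono mult_left_le_one_le)
  finally show ?thesis using norm_grad_\<theta>[OF z, of x] by simp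
qed

text \<open>The two parts of the gradient of \<open>w z k\<close>: the shifts \<open>h k\<close> sum
  to at most 2 H and meet the bound X, while the single active cutoff contributes at most h k times
  D 2 ^ k, that is H D.\<close>

definition C :: real where "C = 2 * H * X + H * D"

text \<open>At every point at most one \<open>\<psi> k\<close> has a nonzero gradient, since the transition layers
  \<open>0 < \<psi> k < 1\<close> are disjoint.\<close>
lemma sum_h_grad_w_le:
  assumes z: "z \<in> Z"
  shows "(\<Sum>k<n. h k * norm (grad (w z k) x)) \<le> C"
proof -
  have X: "X \<ge> 0" by (rule order_trans[OF norm_ge_zero norm_grad_\<theta>[OF z]])
  have "(\<Sum>k<n. h k * norm (grad (w z k) x)) \<le> (\<Sum>k<n. h k * X + h k * norm (grad (\<psi> k) x))"
    unfolding distrib_left[symmetric] using h_pos norm_grad_w[OF z]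
    by (intro sum_mono mult_left_mono) (auto intro: less_imp_le)
  also have "\<dots> = (\<Sum>k<n. h k * X) + (\<Sum>k<n. h k * norm (grad (\<psi> k) x))"
    by (rule sum.distrib)
  also have "(\<Sum>k<n. h k * X) = (\<Sum>k<n. 1 / 2 ^ k) * (H * X)"
    unfolding sum_distrib_right by (simp add: h_def)
  also have "\<dots> \<le> 2 * (H * X)"
    using X H_pos by (intro mult_right_mono sum_inverse_power2_le) auto
  also have "(\<Sum>k<n. h k * norm (grad (\<psi> k) x)) \<le> H * D"
  proof -
    let ?A = "{k \<in> {..<n}. grad (\<psi> k) x \<noteq> 0}"
    have "(\<Sum>k<n. h k * norm (grad (\<psi> k) x)) = (\<Sum>k\<in>?A. h k * norm (grad (\<psi> k) x))"
      by (intro sum.mono_neutral_right) auto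
    also have "\<dots> \<le> of_nat (card ?A) * (H * D)"
    proof (rule sum_bounded_above)
      fix k
      have "h k * norm (grad (\<psi> k) x) \<le> h k * (D * 2 ^ k)"
        using norm_grad_\<psi> h_pos[of k] by (intro mult_left_mono) auto
      then show "h k * norm (grad (\<psi> k) x) \<le> H * D" by (simp add: h_def)
    qed
    also have "\<dots> \<le> 1 * (H * D)"
    proof (rule mult_right_mono)
      have "k = j" if "k \<in> ?A" "j \<in> ?A" for k j
        using that grad_\<psi>_eq_0 \<psi>_later[of k x j] \<psi>_later[of j x k]
        by (metis (mono_tags, lifting) mem_Collect_eq nat_neq_iff)
      then have "card ?A \<le> 1" by (auto simp: card_le_Suc0_iff_eq)
      then show "real (card ?A) \<le> 1" by simp
    qed (use H_pos D_nonneg in simp)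
    finally show ?thesis by simp
  qed
  finally show ?thesis by (simp add: C_def)
qed

lemma h_grad_w_le:
  assumes z: "z \<in> Z"
  shows "h k * norm (grad (w z k) x) \<le> C"
proof -
  have "h k * norm (grad (w z k) x) \<le> (\<Sum>k<Suc k. h k * norm (grad (w z k) x))"
    using h_pos[THEN less_imp_le] by (intro member_le_sum) auto
  then show ?thesis using sum_h_grad_w_le[OF z, of x "Suc k"] by linarith
qed

text \<open>\<open>Ext\<close> is \<open>f\<close> minus the adjoint of \<open>\<nabla>\<phi> \<mapsto> \<nabla>(\<Sum>z k. p z k * \<phi>(\<cdot> + h k *\<^sub>R e z))\<close>.
  \<open>K1\<close> is the part where the derivative falls on \<open>\<phi>\<close>. Where it falls on \<open>p z k\<close>, summation by parts
  leaves \<open>grad (w z (Suc k))\<close> times an increment of \<open>\<phi>\<close> of length \<open>h (Suc k)\<close>, which \<open>K2\<close>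
  writes as an average of \<open>\<nabla>\<phi>\<close> along the segment.\<close>
definition K1 :: "'a \<Rightarrow> nat \<Rightarrow> 'a \<Rightarrow> 'a \<Rightarrow> 'a" where
  "K1 z k x v = p z k x *\<^sub>R v"
definition K2 :: "'a \<Rightarrow> nat \<Rightarrow> 'a \<Rightarrow> 'a \<Rightarrow> 'a" where
  "K2 z k x v = (- (h (Suc k) * (grad (w z (Suc k)) x \<bullet> v))) *\<^sub>R e z"

section \<open>The operator \<open>Ext\<close>, its bound on L1 and its values on \<Omega>\<close>

lemma series1:
  assumes z: "z \<in> Z"
  shows "translation_series (K1 z) 1"
proof (rule translation_series.intro)
  show "linear (K1 z k x)" for k x
    unfolding K1_def[abs_def] by (intro linearI) (auto simp: algebra_simps)
  fix f :: "'a \<Rightarrow> 'a" and k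
  assume [measurable]: "f \<in> borel_measurable borel"
  have [measurable]: "p z k \<in> borel_measurable borel"
    by (intro borel_measurable_continuous_onI smooth_continuous smooth_p z)
  show "(\<lambda>x. K1 z k x (f x)) \<in> borel_measurable borel"
    unfolding K1_def by measurable
next
  fix n x and v :: 'a
  have "(\<Sum>k<n. norm (K1 z k x v)) = (\<Sum>k<n. p z k x) * norm v"
    unfolding sum_distrib_right using p_nonneg[OF z] by (simp add: K1_def)
  also have "\<dots> \<le> 1 * norm v"
    by (intro mult_right_mono sum_p_le z) auto
  finally show "(\<Sum>k<n. norm (K1 z k x v)) \<le> 1 * norm v" .
qed

lemma series2:
  assumes z: "z \<in> Z"
  shows "translation_series (K2 z) C"
proof (rule translation_series.intro)
  show "linear (K2 z k x)" for k x
    unfolding K2_def[abs_def] by (intro linearI) (auto simp: algebra_simps inner_add_right)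
  fix f :: "'a \<Rightarrow> 'a" and k
  assume [measurable]: "f \<in> borel_measurable borel"
  have [measurable]: "grad (w z k) \<in> borel_measurable borel" for k
    by (intro borel_measurable_continuous_onI smooth_continuous_grad smooth_w z)
  show "(\<lambda>x. K2 z k x (f x)) \<in> borel_measurable borel"
    unfolding K2_def by measurable
next
  fix n x and v :: 'a
  have "(\<Sum>k<n. norm (K2 z k x v)) \<le> (\<Sum>k<n. (h (Suc k) * norm (grad (w z (Suc k)) x)) * norm v)"
  proof (rule sum_mono)
    fix k
    have "norm (K2 z k x v) = h (Suc k) * \<bar>grad (w z (Suc k)) x \<bullet> v\<bar>"
      using h_pos[of "Suc k"] by (simp add: K2_def norm_e[OF z] abs_mult)
    also have "\<dots> \<le> h (Suc k) * (norm (grad (w z (Suc k)) x) * norm v)"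
      using h_pos[of "Suc k"] by (intro mult_left_mono Cauchy_Schwarz_ineq2) auto
    finally show "norm (K2 z k x v) \<le> (h (Suc k) * norm (grad (w z (Suc k)) x)) * norm v"
      by (simp add: mult.assoc)
  qed
  also have "\<dots> = (\<Sum>k<n. h (Suc k) * norm (grad (w z (Suc k)) x)) * norm v"
    by (rule sum_distrib_right[symmetric])
  also have "\<dots> \<le> C * norm v"
  proof (rule mult_right_mono)
    have "(\<Sum>k<n. h (Suc k) * norm (grad (w z (Suc k)) x)) \<le> (\<Sum>k<Suc n. h k * norm (grad (w z k) x))"
      unfolding sum.lessThan_Suc_shift using h_pos[of 0] by simp
    then show "(\<Sum>k<n. h (Suc k) * norm (grad (w z (Suc k)) x)) \<le> C"
      using sum_h_grad_w_le[OF z, of x "Suc n"] by linarith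
  qed simp
  finally show "(\<Sum>k<n. norm (K2 z k x v)) \<le> C * norm v" .
qed

definition T1 :: "'a \<Rightarrow> ('a \<Rightarrow> 'a) \<Rightarrow> 'a \<Rightarrow> 'a" where
  "T1 z = translation_series.T (K1 z) (\<lambda>k. h k *\<^sub>R e z) (\<lambda>k. 0)"
text \<open>With base point and direction both \<open>h (Suc k) *\<^sub>R e z\<close>, the shift
  runs from \<open>h (Suc k)\<close> to \<open>2 * h (Suc k)\<close>, which is \<open>h k\<close>:
  the interval between two consecutive shifts.\<close>

definition T2 :: "'a \<Rightarrow> ('a \<Rightarrow> 'a) \<Rightarrow> 'a \<Rightarrow> 'a" where
  "T2 z = translation_series.T (K2 z) (\<lambda>k. h (Suc k) *\<^sub>R e z) (\<lambda>k. h (Suc k) *\<^sub>R e z)"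
definition Ext :: "('a \<Rightarrow> 'a) \<Rightarrow> 'a \<Rightarrow> 'a" where
  "Ext f y = f y - (\<Sum>z\<in>Z. T1 z f y + T2 z f y)"

lemma integrable_T12:
  assumes "z \<in> Z" "integrable lborel f"
  shows "integrable lborel (T1 z f)" "integrable lborel (T2 z f)"
  unfolding T1_def T2_def
  using assms series1 series2 translation_series.integrable_T by blast+

lemma integrable_Ext: "integrable lborel f \<Longrightarrow> integrable lborel (Ext f)"
  unfolding Ext_def[abs_def]
  by (intro Bochner_Integration.integrable_diff Bochner_Integration.integrable_sum
      Bochner_Integration.integrable_add integrable_T12)

lemma integral_norm_Ext_le:
  assumes f: "integrable lborel f"
  shows "(\<integral>y. norm (Ext f y) \<partial>lborel) \<le> (1 + card Z * (1 + C)) * (\<integral>y. norm (f y) \<partial>lborel)"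
proof -
  let ?N = "\<integral>y. norm (f y) \<partial>lborel"
  have "(\<integral>y. norm (Ext f y) \<partial>lborel)
      \<le> (\<integral>y. norm (f y) + (\<Sum>z\<in>Z. norm (T1 z f y) + norm (T2 z f y)) \<partial>lborel)"
  proof (rule integral_mono)
    fix y
    show "norm (Ext f y) \<le> norm (f y) + (\<Sum>z\<in>Z. norm (T1 z f y) + norm (T2 z f y))"
      unfolding Ext_def
      by (intro norm_triangle_le_diff add_mono order.refl sum_norm_le norm_triangle_ineq)
  qed (use f integrable_Ext integrable_T12 in auto)
  also have "\<dots> = ?N + (\<Sum>z\<in>Z. (\<integral>y. norm (T1 z f y) \<partial>lborel) + (\<integral>y. norm (T2 z f y) \<partial>lborel))"
    using f integrable_T12 by (simp add: Bochner_Integration.integral_sum)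
  also have "\<dots> \<le> ?N + (\<Sum>z\<in>Z. 1 * ?N + C * ?N)"
  proof (intro add_mono order.refl sum_mono)
    fix z assume z: "z \<in> Z"
    show "(\<integral>y. norm (T1 z f y) \<partial>lborel) \<le> 1 * ?N"
      unfolding T1_def by (rule translation_series.integral_norm_T_le[OF series1[OF z] f])
    show "(\<integral>y. norm (T2 z f y) \<partial>lborel) \<le> C * ?N"
      unfolding T2_def by (rule translation_series.integral_norm_T_le[OF series2[OF z] f])
  qed
  also have "\<dots> = (1 + card Z * (1 + C)) * ?N"
    by (simp add: algebra_simps)
  finally show ?thesis .
qed

lemma Ext_linear_AE:
  assumes f: "integrable lborel f" and g: "integrable lborel g"
  shows "AE y in lborel. Ext (\<lambda>x. a *\<^sub>R f x + b *\<^sub>R g x) y = a *\<^sub>R Ext f y + b *\<^sub>R Ext g y"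
proof -
  have "AE y in lborel. \<forall>z\<in>Z. T1 z (\<lambda>x. a *\<^sub>R f x + b *\<^sub>R g x) y = a *\<^sub>R T1 z f y + b *\<^sub>R T1 z g y"
    unfolding T1_def using finite_Z
    by (intro AE_finite_allI translation_series.T_linear_AE[OF series1 f g])
  moreover have "AE y in lborel. \<forall>z\<in>Z. T2 z (\<lambda>x. a *\<^sub>R f x + b *\<^sub>R g x) y = a *\<^sub>R T2 z f y + b *\<^sub>R T2 z g y"
    unfolding T2_def using finite_Z
    by (intro AE_finite_allI translation_series.T_linear_AE[OF series2 f g])
  ultimately show ?thesis
  proof eventually_elim
    case (elim y)
    have "(\<Sum>z\<in>Z. T1 z (\<lambda>x. a *\<^sub>R f x + b *\<^sub>R g x) y + T2 z (\<lambda>x. a *\<^sub>R f x + b *\<^sub>R g x) y)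
      = (\<Sum>z\<in>Z. a *\<^sub>R (T1 z f y + T2 z f y) + b *\<^sub>R (T1 z g y + T2 z g y))"
      using elim by (intro sum.cong) (auto simp: algebra_simps)
    then show ?case
      by (simp add: Ext_def sum.distrib scaleR_sum_right algebra_simps)
  qed
qed

text \<open>The norm bound applied to the difference gives 0. Representatives of a linear
  combination agree with the combination of representatives only a.e., and this carries the
  agreement through \<open>Ext\<close>.\<close>

lemma Ext_cong_AE:
  assumes f: "integrable lborel f" and g: "integrable lborel g" and eq: "AE x in lborel. f x = g x"
  shows "AE y in lborel. Ext f y = Ext g y"
proof -
  let ?d = "\<lambda>x. 1 *\<^sub>R f x + (- 1) *\<^sub>R g x"
  have d: "integrable lborel ?d" using f g by simp
  have "(\<integral>x. norm (?d x) \<partial>lborel) = (\<integral>x. 0 \<partial>(lborel :: 'a measure))"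
    using eq d by (intro integral_cong_AE) auto
  then have "(\<integral>y. norm (Ext ?d y) \<partial>lborel) \<le> 0"
    using integral_norm_Ext_le[OF d] by simp
  then have "(\<integral>y. norm (Ext ?d y) \<partial>lborel) = 0"
    by (simp add: antisym)
  then have "AE y in lborel. norm (Ext ?d y) = 0"
    using integrable_Ext[OF d] by (subst (asm) integral_nonneg_eq_0_iff_AE) auto
  then show ?thesis
    using Ext_linear_AE[OF f g, of 1 "- 1"] by eventually_elim simp
qed

text \<open>Mass at a point of \<Omega> is only sent out of \<Omega>: where a weight is nonzero,
  \<open>exit_near\<close> applies to every shift combined with it. So all correction terms vanish
  at every point of \<Omega>, not just almost everywhere.\<close>

lemma Ext_eq_on_dom:
  assumes f: "\<And>x. x \<notin> \<Omega> \<Longrightarrow> f x = 0" and y: "y \<in> \<Omega>"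
  shows "Ext f y = f y"
proof -
  have "T1 z f y = 0" if z: "z \<in> Z" for z
  proof -
    have "K1 z k (y - h k *\<^sub>R e z) (f (y - h k *\<^sub>R e z)) = 0" for k
    proof (rule ccontr)
      let ?x = "y - h k *\<^sub>R e z"
      assume nz: "K1 z k ?x (f ?x) \<noteq> 0"
      then have "?x \<in> \<Omega>" using f by (auto simp: K1_def)
      moreover have "\<theta> z ?x \<noteq> 0" using nz by (auto simp: K1_def p_def)
      \<comment> \<open>If \<open>\<psi> k\<close> were 1 there, so would be
        \<open>\<psi> (Suc k)\<close>, and the weight would be 0.\<close>
      moreover have "\<psi> k ?x \<noteq> 1" using nz \<psi>_step[of k ?x] by (auto simp: K1_def p_def)
      ultimately have "?x + h k *\<^sub>R e z \<notin> \<Omega>"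
        using z h_le[of k] by (intro exit_near[of z ?x k]) (auto simp: h_def)
      with y show False by simp
    qed
    then show ?thesis
      by (simp add: T1_def translation_series.T_def[OF series1[OF z]] segment_avg_def)
  qed
  moreover have "T2 z f y = 0" if z: "z \<in> Z" for z
  proof -
    have 0: "indicator {0..1} t *\<^sub>R K2 z k (y - (h (Suc k) *\<^sub>R e z + t *\<^sub>R (h (Suc k) *\<^sub>R e z)))
        (f (y - (h (Suc k) *\<^sub>R e z + t *\<^sub>R (h (Suc k) *\<^sub>R e z)))) = 0" for k and t :: real
    proof (rule ccontr)
      let ?x = "y - (h (Suc k) *\<^sub>R e z + t *\<^sub>R (h (Suc k) *\<^sub>R e z))"
      assume nz: "\<not> ?thesis"
      then have t: "0 \<le> t" "t \<le> 1" by (auto simp: indicator_def split: if_splits)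
      have K: "K2 z k ?x (f ?x) \<noteq> 0" using nz by auto
      have "?x \<in> \<Omega>"
      proof (rule ccontr)
        assume "?x \<notin> \<Omega>"
        then have "f ?x = 0" by (rule f)
        with K show False by (simp only: K2_def inner_zero_right mult_zero_right minus_zero scaleR_zero_left simp_thms)
      qed
      moreover have "grad (w z (Suc k)) ?x \<noteq> 0"
      proof
        assume "grad (w z (Suc k)) ?x = 0"
        with K show False by (simp only: K2_def inner_zero_left mult_zero_right minus_zero scaleR_zero_left simp_thms)
      qed
      moreover then have "\<theta> z ?x \<noteq> 0" "\<psi> (Suc k) ?x \<noteq> 1"
        using grad_w_eq_0[OF z, of "Suc k" ?x] by (auto simp: w_def)
      \<comment> \<open>The shift (1 + t) h (Suc k) lies between h (Suc k) and h k, within the range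
        of \<open>exit_near\<close>.\<close>
      moreover have "H / 2 ^ Suc k \<le> h (Suc k) + t * h (Suc k)"
        unfolding h_def[symmetric] using t h_pos[of "Suc k"] by simp
      moreover have "h (Suc k) + t * h (Suc k) \<le> H"
      proof -
        have "t * h (Suc k) \<le> 1 * h (Suc k)"
          using t h_pos[of "Suc k"] by (intro mult_right_mono) auto
        then show ?thesis using h_Suc[of k] h_le[of k] by linarith
      qed
      ultimately have "?x + (h (Suc k) + t * h (Suc k)) *\<^sub>R e z \<notin> \<Omega>"
        using z by (intro exit_near[of z ?x "Suc k"])
      with y show False by (simp add: algebra_simps)
    qed
    show ?thesis
      unfolding T2_def translation_series.T_def[OF series2[OF z]] segment_avg_def 0 by simp
  qed
  ultimately show ?thesis by (simp add: Ext_def)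
qed

section \<open>Duality with test functions\<close>

lemma segment_avg_grad:
  assumes "smooth_fun \<phi>"
  shows "segment_avg (- q) (- q) (grad \<phi>) x \<bullet> q = \<phi> (x + 2 *\<^sub>R q) - \<phi> (x + q)"
proof -
  \<comment> \<open>The reversed signs belong to the adjoint: the gradient is evaluated at x + q + t
    q, so its integral is the increment of \<phi> from x + q to x + 2 q.\<close>
  let ?G = "\<lambda>t. grad \<phi> (x - (- q + t *\<^sub>R (- q)))"
  have cont: "continuous_on S ?G" for S
    by (intro continuous_on_compose2[OF smooth_continuous_grad[OF assms, of UNIV]] continuous_intros) auto
  have "segment_avg (- q) (- q) (grad \<phi>) x \<bullet> q
      = (\<integral>t. (indicator {0..1} (t::real) *\<^sub>R ?G t) \<bullet> q \<partial>lborel)"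
    unfolding segment_avg_def
    by (intro integral_inner_left[symmetric] borel_integrable_compact cont) auto
  also have "\<dots> = (\<integral>t. (?G t \<bullet> q) * indicator {0..1} t \<partial>lborel)"
    by (simp add: mult.commute)
  also have "\<dots> = \<phi> (x - (- q + 1 *\<^sub>R (- q))) - \<phi> (x - (- q + 0 *\<^sub>R (- q)))"
  proof (rule integral_FTC_Icc_real)
    fix t :: real
    have "((\<lambda>t. \<phi> (x - (- q + t *\<^sub>R (- q)))) has_derivative (\<lambda>s. ?G t \<bullet> (s *\<^sub>R q))) (at t)"
      by (rule has_derivative_compose[OF _ smooth_has_derivative[OF assms]])
         (auto intro!: derivative_eq_intros)
    then show "((\<lambda>t. \<phi> (x - (- q + t *\<^sub>R (- q)))) has_real_derivative ?G t \<bullet> q) (at t)"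
      by (simp add: has_field_derivative_def mult_commute_abs)
    show "isCont (\<lambda>t. ?G t \<bullet> q) t"
      using cont[of UNIV] by (intro continuous_intros) (simp add: continuous_on_eq_continuous_at)
  qed simp
  also have "\<dots> = \<phi> (x + 2 *\<^sub>R q) - \<phi> (x + q)"
    by (simp add: scaleR_2 algebra_simps)
  finally show ?thesis .
qed

lemma segment_avg_0: "segment_avg q 0 G x = G (x - q)"
  by (simp add: segment_avg_def)

text \<open>Truncating the sum after \<open>n\<close> terms, and replacing its tail by \<open>(1 - \<psi> n) * \<phi>\<close>, makes
  \<open>\<phi> - (\<Sum>z k. p z k * \<phi>(\<cdot> + h k *\<^sub>R e z))\<close> an admissible test function on \<open>\<Omega>\<close>.\<close>
definition \<tau> :: "('a \<Rightarrow> real) \<Rightarrow> nat \<Rightarrow> 'a \<Rightarrow> real" where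
  "\<tau> \<phi> n x = \<psi> n x * \<phi> x - (\<Sum>z\<in>Z. \<Sum>k<n. p z k x * \<phi> (x + h k *\<^sub>R e z))"

text \<open>Where \<open>\<psi> n\<close> is 0, all earlier cutoffs are 0 too, since a nonzero one
  would force \<open>\<psi> n\<close> to be 1. So every weight with k < n vanishes, and the support
  is controlled by \<open>\<psi> n\<close> alone.\<close>

lemma test_fun_\<tau>:
  assumes "smooth_fun \<phi>"
  shows "test_fun \<Omega> (\<tau> \<phi> n)"
  unfolding test_fun_def
proof
  show "smooth_fun (\<tau> \<phi> n)"
    unfolding \<tau>_def[abs_def] by (intro smooth_intros smooth_\<psi> smooth_p assms)
  obtain S where S: "compact S" "S \<subseteq> \<Omega>" "\<And>x. \<psi> n x \<noteq> 0 \<Longrightarrow> x \<in> S"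
    using \<psi>_support[of n] by blast
  have "\<tau> \<phi> n x = 0" if "x \<notin> S" for x
  proof -
    have 0: "\<psi> n x = 0" using S(3) that by blast
    have k0: "\<psi> k x = 0" if "k \<le> n" for k
      using \<psi>_later[of k x n] 0 that by (cases "k = n") auto
    have "p z k x = 0" if "k < n" for z k
      using k0[of k] k0[of "Suc k"] that by (simp add: p_def)
    then show ?thesis by (simp add: \<tau>_def 0)
  qed
  with S show "\<exists>K. compact K \<and> K \<subseteq> \<Omega> \<and> (\<forall>x. x \<notin> K \<longrightarrow> \<tau> \<phi> n x = 0)" by blast
qed

text \<open>On \<Omega> the functions \<open>w z n\<close> sum to \<open>1 - \<psi> n\<close>:
  either \<open>\<psi> n\<close> is 1, or the point lies in the strip where the partition sums to 1.
  The identity can be differentiated because it holds on an open set.\<close>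

lemma sum_grad_w:
  assumes x: "x \<in> \<Omega>"
  shows "(\<Sum>z\<in>Z. grad (w z n) x) = - grad (\<psi> n) x"
proof -
  have "(\<Sum>z\<in>Z. grad (w z n) x) = grad (\<lambda>x. \<Sum>z\<in>Z. w z n x) x"
    by (intro grad_sum[symmetric] smooth_w)
  also have "\<dots> = grad (\<lambda>x. 1 - \<psi> n x) x"
  proof (rule grad_eq_on_open[OF open_dom x])
    fix y assume y: "y \<in> \<Omega>"
    have "(\<Sum>z\<in>Z. w z n y) = (\<Sum>z\<in>Z. \<theta> z y) * (1 - \<psi> n y)"
      by (simp add: w_def sum_distrib_right)
    also have "\<dots> = 1 - \<psi> n y"
    proof (cases "\<psi> n y = 1")
      case False
      then have "\<psi> 0 y \<noteq> 1" using \<psi>_eq_1_later[of 0 y n] by auto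
      then show ?thesis using sum_\<theta>_eq[OF y] by simp
    qed simp
    finally show "(\<Sum>z\<in>Z. w z n y) = 1 - \<psi> n y" .
  qed (intro smooth_intros smooth_\<psi>)
  also have "\<dots> = - grad (\<psi> n) x"
    by (simp add: grad_diff smooth_const smooth_\<psi> grad_const)
  finally show ?thesis .
qed

text \<open>In this form every gradient of a \<open>w z k\<close> is multiplied by an increment of
  \<phi> over the length \<open>h k\<close>, which compensates its growth.\<close>

lemma grad_\<tau>:
  assumes \<phi>: "smooth_fun \<phi>" and supp: "\<forall>x. x \<notin> \<Omega>' \<longrightarrow> \<phi> x = 0" and x: "x \<in> \<Omega>"
  shows "grad (\<tau> \<phi> n) x = \<psi> n x *\<^sub>R grad \<phi> x
    - (\<Sum>z\<in>Z. \<Sum>k<n. p z k x *\<^sub>R grad \<phi> (x + h k *\<^sub>R e z))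
    - (\<Sum>z\<in>Z. \<Sum>k<n. (\<phi> (x + h (Suc k) *\<^sub>R e z) - \<phi> (x + h k *\<^sub>R e z)) *\<^sub>R grad (w z (Suc k)) x)
    + (\<Sum>z\<in>Z. (\<phi> (x + h n *\<^sub>R e z) - \<phi> x) *\<^sub>R grad (w z n) x)"
proof -
  note sm = smooth_intros smooth_\<psi> smooth_p smooth_w \<phi>
  let ?\<phi> = "\<lambda>z k. \<phi> (x + h k *\<^sub>R e z)"
  have parts: "(\<Sum>k<n. ?\<phi> z k *\<^sub>R grad (p z k) x)
      = (\<Sum>k<n. (?\<phi> z (Suc k) - ?\<phi> z k) *\<^sub>R grad (w z (Suc k)) x) - ?\<phi> z n *\<^sub>R grad (w z n) x"
    if z: "z \<in> Z" for z
  proof -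
    \<comment> \<open>Boundary term at k = 0: where \<open>w z 0\<close> is nonzero, the shift by
      \<open>H\<close> leaves \<open>\<Omega>'\<close> and \<phi> is 0 there; elsewhere the gradient
      of \<open>w z 0\<close> is 0.\<close>
    have "?\<phi> z 0 *\<^sub>R grad (w z 0) x = 0"
    proof (cases "w z 0 x = 0")
      case True
      then show ?thesis using grad_w_eq_0[OF z] by simp
    next
      case False
      then have "\<theta> z x \<noteq> 0" "\<psi> 0 x \<noteq> 1" by (auto simp: w_def)
      then have "x + h 0 *\<^sub>R e z \<notin> \<Omega>'" using exit_far[OF z x] by (simp add: h_0)
      then show ?thesis using supp by simp
    qed
    then show ?thesis
      using sum_by_parts[of "?\<phi> z" "\<lambda>k. grad (w z k) x" n] by (simp add: grad_p[OF z])
  qed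
  have "grad (\<tau> \<phi> n) x = \<phi> x *\<^sub>R grad (\<psi> n) x + \<psi> n x *\<^sub>R grad \<phi> x
      - (\<Sum>z\<in>Z. \<Sum>k<n. ?\<phi> z k *\<^sub>R grad (p z k) x + p z k x *\<^sub>R grad \<phi> (x + h k *\<^sub>R e z))"
  proof -
    have "grad (\<tau> \<phi> n) x = grad (\<lambda>x. \<psi> n x * \<phi> x) x
        - grad (\<lambda>x. \<Sum>z\<in>Z. \<Sum>k<n. p z k x * \<phi> (x + h k *\<^sub>R e z)) x"
      unfolding \<tau>_def[abs_def] by (intro grad_diff sm)
    also have "grad (\<lambda>x. \<psi> n x * \<phi> x) x = \<phi> x *\<^sub>R grad (\<psi> n) x + \<psi> n x *\<^sub>R grad \<phi> x"
      by (intro grad_mult sm)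
    also have "grad (\<lambda>x. \<Sum>z\<in>Z. \<Sum>k<n. p z k x * \<phi> (x + h k *\<^sub>R e z)) x
        = (\<Sum>z\<in>Z. grad (\<lambda>x. \<Sum>k<n. p z k x * \<phi> (x + h k *\<^sub>R e z)) x)"
      by (intro grad_sum sm)
    also have "\<dots> = (\<Sum>z\<in>Z. \<Sum>k<n. grad (\<lambda>x. p z k x * \<phi> (x + h k *\<^sub>R e z)) x)"
      by (intro sum.cong refl grad_sum sm)
    also have "\<dots> = (\<Sum>z\<in>Z. \<Sum>k<n. ?\<phi> z k *\<^sub>R grad (p z k) x + p z k x *\<^sub>R grad \<phi> (x + h k *\<^sub>R e z))"
    proof (intro sum.cong refl)
      fix z k assume "z \<in> Z"
      then show "grad (\<lambda>x. p z k x * \<phi> (x + h k *\<^sub>R e z)) x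
        = ?\<phi> z k *\<^sub>R grad (p z k) x + p z k x *\<^sub>R grad \<phi> (x + h k *\<^sub>R e z)"
        by (subst grad_mult) (auto intro!: sm simp: grad_shift[OF \<phi>])
    qed
    finally show ?thesis .
  qed
  also have "\<dots> = \<phi> x *\<^sub>R grad (\<psi> n) x + \<psi> n x *\<^sub>R grad \<phi> x
      - (\<Sum>z\<in>Z. \<Sum>k<n. p z k x *\<^sub>R grad \<phi> (x + h k *\<^sub>R e z))
      - (\<Sum>z\<in>Z. \<Sum>k<n. (?\<phi> z (Suc k) - ?\<phi> z k) *\<^sub>R grad (w z (Suc k)) x)
      + (\<Sum>z\<in>Z. ?\<phi> z n *\<^sub>R grad (w z n) x)"
  proof -
    have "(\<Sum>z\<in>Z. \<Sum>k<n. ?\<phi> z k *\<^sub>R grad (p z k) x)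
      = (\<Sum>z\<in>Z. (\<Sum>k<n. (?\<phi> z (Suc k) - ?\<phi> z k) *\<^sub>R grad (w z (Suc k)) x) - ?\<phi> z n *\<^sub>R grad (w z n) x)"
      by (intro sum.cong refl parts)
    then show ?thesis by (simp add: sum.distrib sum_subtractf)
  qed
  \<comment> \<open>The derivative of the cutoff thus joins the boundary term at k = n and turns its
    coefficients into increments of \<phi> of length \<open>h n\<close>.\<close>
  also have "\<phi> x *\<^sub>R grad (\<psi> n) x = - (\<Sum>z\<in>Z. \<phi> x *\<^sub>R grad (w z n) x)"
    unfolding scaleR_sum_right[symmetric] sum_grad_w[OF x] by simp
  finally show ?thesis
    by (simp add: sum_subtractf scaleR_diff_left)
qed

text \<open>The bound is uniform in \<open>n\<close>, as dominated convergence requires. Increments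
  of \<phi> are at most \<open>B\<close> times the difference of the shifts, and these lengths times
  the gradients of the \<open>w z k\<close> sum to at most \<open>C\<close>.\<close>

lemma norm_grad_\<tau>_le:
  fixes B :: real
  assumes \<phi>: "smooth_fun \<phi>" and supp: "\<forall>x. x \<notin> \<Omega>' \<longrightarrow> \<phi> x = 0" and x: "x \<in> \<Omega>"
    and B: "\<And>x. norm (grad \<phi> x) \<le> B"
  shows "norm (grad (\<tau> \<phi> n) x) \<le> B + card Z * B + card Z * (B * C) + card Z * (B * C)"
proof -
  have B0: "B \<ge> 0" by (rule order_trans[OF norm_ge_zero B[of x]])
  note lip = smooth_lipschitz[OF \<phi> B]
  have "norm (\<psi> n x *\<^sub>R grad \<phi> x) \<le> 1 * B"
    unfolding norm_scaleR using \<psi>_nonneg[of n x] \<psi>_le[of n x] B by (intro mult_mono) auto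
  moreover have "norm (\<Sum>z\<in>Z. \<Sum>k<n. p z k x *\<^sub>R grad \<phi> (x + h k *\<^sub>R e z)) \<le> card Z * B"
  proof -
    have "norm (\<Sum>k<n. p z k x *\<^sub>R grad \<phi> (x + h k *\<^sub>R e z)) \<le> B" if z: "z \<in> Z" for z
    proof -
      have "norm (\<Sum>k<n. p z k x *\<^sub>R grad \<phi> (x + h k *\<^sub>R e z)) \<le> (\<Sum>k<n. p z k x * B)"
        using p_nonneg[OF z] B by (intro sum_norm_le) (auto intro: mult_left_mono)
      also have "\<dots> \<le> 1 * B"
        unfolding sum_distrib_right[symmetric] by (intro mult_right_mono sum_p_le z B0)
      finally show ?thesis by simp
    qed
    then show ?thesis by (intro order_trans[OF norm_sum sum_bounded_above])
  qed
  moreover have "norm (\<Sum>z\<in>Z. \<Sum>k<n. (\<phi> (x + h (Suc k) *\<^sub>R e z) - \<phi> (x + h k *\<^sub>R e z)) *\<^sub>R grad (w z (Suc k)) x)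
      \<le> card Z * (B * C)"
  proof -
    have "norm (\<Sum>k<n. (\<phi> (x + h (Suc k) *\<^sub>R e z) - \<phi> (x + h k *\<^sub>R e z)) *\<^sub>R grad (w z (Suc k)) x) \<le> B * C"
      if z: "z \<in> Z" for z
    proof -
      have "norm (\<Sum>k<n. (\<phi> (x + h (Suc k) *\<^sub>R e z) - \<phi> (x + h k *\<^sub>R e z)) *\<^sub>R grad (w z (Suc k)) x)
          \<le> (\<Sum>k<n. B * (h (Suc k) * norm (grad (w z (Suc k)) x)))"
      proof (rule sum_norm_le)
        fix k
        have "(x + h (Suc k) *\<^sub>R e z) - (x + h k *\<^sub>R e z) = (- h (Suc k)) *\<^sub>R e z"
          by (simp add: h_Suc[of k] flip: scaleR_diff_left)
        then have "\<bar>\<phi> (x + h (Suc k) *\<^sub>R e z) - \<phi> (x + h k *\<^sub>R e z)\<bar> \<le> B * h (Suc k)"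
          using lip[of "x + h (Suc k) *\<^sub>R e z" "x + h k *\<^sub>R e z"] norm_e[OF z] h_pos[of "Suc k"] by simp
        then have "\<bar>\<phi> (x + h (Suc k) *\<^sub>R e z) - \<phi> (x + h k *\<^sub>R e z)\<bar> * norm (grad (w z (Suc k)) x)
            \<le> (B * h (Suc k)) * norm (grad (w z (Suc k)) x)"
          by (rule mult_right_mono) simp
        then show "norm ((\<phi> (x + h (Suc k) *\<^sub>R e z) - \<phi> (x + h k *\<^sub>R e z)) *\<^sub>R grad (w z (Suc k)) x)
            \<le> B * (h (Suc k) * norm (grad (w z (Suc k)) x))"
          by (simp add: mult.assoc)
      qed
      also have "\<dots> = B * (\<Sum>k<n. h (Suc k) * norm (grad (w z (Suc k)) x))"
        by (rule sum_distrib_left[symmetric])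
      also have "\<dots> \<le> B * C"
      proof (intro mult_left_mono B0)
        have "0 \<le> h 0 * norm (grad (w z 0) x)" using h_pos[of 0] by simp
        then show "(\<Sum>k<n. h (Suc k) * norm (grad (w z (Suc k)) x)) \<le> C"
          using sum_h_grad_w_le[OF z, of x "Suc n"] unfolding sum.lessThan_Suc_shift by linarith
      qed
      finally show ?thesis .
    qed
    then show ?thesis by (intro order_trans[OF norm_sum sum_bounded_above])
  qed
  moreover have "norm (\<Sum>z\<in>Z. (\<phi> (x + h n *\<^sub>R e z) - \<phi> x) *\<^sub>R grad (w z n) x) \<le> card Z * (B * C)"
  proof -
    have "norm ((\<phi> (x + h n *\<^sub>R e z) - \<phi> x) *\<^sub>R grad (w z n) x) \<le> B * C" if z: "z \<in> Z" for z
    proof -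
      have "\<bar>\<phi> (x + h n *\<^sub>R e z) - \<phi> x\<bar> \<le> B * h n"
        using lip[of "x + h n *\<^sub>R e z" x] norm_e[OF z] h_pos[of n] by simp
      then have "norm ((\<phi> (x + h n *\<^sub>R e z) - \<phi> x) *\<^sub>R grad (w z n) x) \<le> (B * h n) * norm (grad (w z n) x)"
        unfolding norm_scaleR real_norm_def by (rule mult_right_mono) simp
      also have "\<dots> \<le> B * C"
        unfolding mult.assoc by (intro mult_left_mono h_grad_w_le z B0)
      finally show ?thesis .
    qed
    then show ?thesis by (intro order_trans[OF norm_sum sum_bounded_above])
  qed
  ultimately show ?thesis
    unfolding grad_\<tau>[OF \<phi> supp x]
    by (intro norm_triangle_le norm_triangle_le_diff add_mono) simp_all
qed

text \<open>Testing \<open>f\<close> with \<open>\<tau> \<phi> n\<close> gives 0 for each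
  \<open>n\<close>. The limit integrand \<open>F\<close> pairs \<open>f\<close> with the gradient of
  \<phi> minus its reflection, and by the adjoint formulas it has the same integral as
  \<open>Ext f\<close> paired with the gradient of \<phi>.\<close>

lemma Ext_divergence_free:
  assumes f: "integrable lborel f" and f0: "\<And>x. x \<notin> \<Omega> \<Longrightarrow> f x = 0"
    and div: "\<And>g. test_fun \<Omega> g \<Longrightarrow> (\<integral>x. f x \<bullet> grad g x \<partial>lborel) = 0"
    and test: "test_fun \<Omega>' \<phi>"
  shows "(\<integral>x. Ext f x \<bullet> grad \<phi> x \<partial>lborel) = 0"
proof -
  have \<phi>: "smooth_fun \<phi>" using test by (simp add: test_fun_def)
  obtain S where S: "compact S" "S \<subseteq> \<Omega>'" "\<And>x. x \<notin> S \<Longrightarrow> \<phi> x = 0"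
    using test unfolding test_fun_def by blast
  have supp: "\<forall>x. x \<notin> \<Omega>' \<longrightarrow> \<phi> x = 0" using S by blast
  obtain B where B: "\<And>x. norm (grad \<phi> x) \<le> B"
    by (rule smooth_compact_support_grad_bounded[OF \<phi> S(1,3)]) (auto intro: that)
  have cont: "continuous_on UNIV (grad \<phi>)" by (rule smooth_continuous_grad[OF \<phi>])
  have mG: "grad g \<in> borel_measurable lborel" if "smooth_fun g" for g :: "'a \<Rightarrow> real"
    using borel_measurable_continuous_onI[OF smooth_continuous_grad[OF that]] by simp
  define H1 where "H1 z x = (\<Sum>k. K1 z k x (f x) \<bullet> segment_avg (- (h k *\<^sub>R e z)) (- 0) (grad \<phi>) x)" for z x
  define H2 where "H2 z x = (\<Sum>k. K2 z k x (f x) \<bullet>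
    segment_avg (- (h (Suc k) *\<^sub>R e z)) (- (h (Suc k) *\<^sub>R e z)) (grad \<phi>) x)" for z x
  have 1: "integrable lborel (H1 z)" "(\<integral>x. T1 z f x \<bullet> grad \<phi> x \<partial>lborel) = (\<integral>x. H1 z x \<partial>lborel)"
    if z: "z \<in> Z" for z
    using translation_series.T_adjoint[OF series1[OF z] f cont B, where p = "\<lambda>k. h k *\<^sub>R e z" and q = "\<lambda>k. 0"]
    unfolding H1_def[abs_def] T1_def by blast+
  have 2: "integrable lborel (H2 z)" "(\<integral>x. T2 z f x \<bullet> grad \<phi> x \<partial>lborel) = (\<integral>x. H2 z x \<partial>lborel)"
    if z: "z \<in> Z" for z
    using translation_series.T_adjoint[OF series2[OF z] f cont B, where p = "\<lambda>k. h (Suc k) *\<^sub>R e z"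
        and q = "\<lambda>k. h (Suc k) *\<^sub>R e z"]
    unfolding H2_def[abs_def] T2_def by blast+
  note ib = integrable_inner_bounded[OF _ mG[OF \<phi>] B]
  define F where "F x = f x \<bullet> grad \<phi> x - (\<Sum>z\<in>Z. H1 z x + H2 z x)" for x
  have "(\<integral>x. Ext f x \<bullet> grad \<phi> x \<partial>lborel)
      = (\<integral>x. f x \<bullet> grad \<phi> x - (\<Sum>z\<in>Z. T1 z f x \<bullet> grad \<phi> x + T2 z f x \<bullet> grad \<phi> x) \<partial>lborel)"
    by (simp add: Ext_def inner_diff_left inner_sum_left inner_add_left)
  also have "\<dots> = (\<integral>x. f x \<bullet> grad \<phi> x \<partial>lborel)
      - (\<Sum>z\<in>Z. (\<integral>x. T1 z f x \<bullet> grad \<phi> x \<partial>lborel) + (\<integral>x. T2 z f x \<bullet> grad \<phi> x \<partial>lborel))"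
    using ib[OF f] ib[OF integrable_T12(1)[OF _ f]] ib[OF integrable_T12(2)[OF _ f]] by simp
  also have "\<dots> = (\<integral>x. f x \<bullet> grad \<phi> x \<partial>lborel) - (\<Sum>z\<in>Z. (\<integral>x. H1 z x \<partial>lborel) + (\<integral>x. H2 z x \<partial>lborel))"
    using 1(2) 2(2) by simp
  also have "\<dots> = (\<integral>x. F x \<partial>lborel)"
    unfolding F_def using ib[OF f] 1(1) 2(1) by simp
  finally have eq: "(\<integral>x. Ext f x \<bullet> grad \<phi> x \<partial>lborel) = (\<integral>x. F x \<partial>lborel)" .
  have sF: "integrable lborel F"
    unfolding F_def[abs_def] using ib[OF f] 1(1) 2(1) by simp
  have lim: "(\<lambda>n. f x \<bullet> grad (\<tau> \<phi> n) x) \<longlonglongrightarrow> F x" for x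
  proof (cases "x \<in> \<Omega>")
    case False
    then have "f x = 0" by (rule f0)
    then have "F x = 0" by (simp add: F_def H1_def H2_def K1_def K2_def)
    then show ?thesis by (simp add: \<open>f x = 0\<close>)
  next
    case x: True
    \<comment> \<open>From the index where a cutoff reaches 1 at \<open>x\<close>, the sequence is
      constant at \<open>x\<close>: all later weights and gradients of \<open>w\<close> vanish
      there.\<close>
    obtain m where m: "\<psi> m x = 1" using \<psi>_exhausts[OF x] by blast
    have \<psi>1: "\<psi> k x = 1" if "k \<ge> m" for k using \<psi>_eq_1_later[OF m that] .
    have "f x \<bullet> grad (\<tau> \<phi> n) x = F x" if n: "n \<ge> m" for n
    proof -
      have p0: "p z k x = 0" if "k \<ge> n" for z k
        using \<psi>1[of k] \<psi>1[of "Suc k"] that n by (simp add: p_def)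
      have w0: "grad (w z k) x = 0" if "z \<in> Z" "k \<ge> n" for z k
        using \<psi>1[of k] that n by (intro grad_w_eq_0) (auto simp: w_def)
      have H1: "H1 z x = (\<Sum>k<n. p z k x * (f x \<bullet> grad \<phi> (x + h k *\<^sub>R e z)))" if z: "z \<in> Z" for z
      proof -
        have "H1 z x = (\<Sum>k. p z k x * (f x \<bullet> grad \<phi> (x + h k *\<^sub>R e z)))"
          by (simp add: H1_def K1_def segment_avg_0)
        also have "\<dots> = (\<Sum>k<n. p z k x * (f x \<bullet> grad \<phi> (x + h k *\<^sub>R e z)))"
          by (rule suminf_finite) (auto simp: p0)
        finally show ?thesis .
      qed
      have H2: "H2 z x = (\<Sum>k<n. (\<phi> (x + h (Suc k) *\<^sub>R e z) - \<phi> (x + h k *\<^sub>R e z)) * (f x \<bullet> grad (w z (Suc k)) x))"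
        if z: "z \<in> Z" for z
      proof -
        have "K2 z k x (f x) \<bullet> segment_avg (- (h (Suc k) *\<^sub>R e z)) (- (h (Suc k) *\<^sub>R e z)) (grad \<phi>) x
          = (\<phi> (x + h (Suc k) *\<^sub>R e z) - \<phi> (x + h k *\<^sub>R e z)) * (f x \<bullet> grad (w z (Suc k)) x)" for k
        proof -
          let ?A = "segment_avg (- (h (Suc k) *\<^sub>R e z)) (- (h (Suc k) *\<^sub>R e z)) (grad \<phi>) x"
          have "K2 z k x (f x) \<bullet> ?A = - (grad (w z (Suc k)) x \<bullet> f x) * (?A \<bullet> (h (Suc k) *\<^sub>R e z))"
            by (simp add: K2_def inner_commute)
          \<comment> \<open>The average yields the increment from the smaller to the larger shift;
            summation by parts needs the opposite one, hence the minus sign in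
            \<open>K2\<close>.\<close>
          also have "?A \<bullet> (h (Suc k) *\<^sub>R e z) = \<phi> (x + h k *\<^sub>R e z) - \<phi> (x + h (Suc k) *\<^sub>R e z)"
            unfolding segment_avg_grad[OF \<phi>] by (simp add: h_Suc[of k])
          finally show ?thesis by (simp add: inner_commute algebra_simps)
        qed
        then have "H2 z x = (\<Sum>k. (\<phi> (x + h (Suc k) *\<^sub>R e z) - \<phi> (x + h k *\<^sub>R e z)) * (f x \<bullet> grad (w z (Suc k)) x))"
          by (simp add: H2_def)
        also have "\<dots> = (\<Sum>k<n. (\<phi> (x + h (Suc k) *\<^sub>R e z) - \<phi> (x + h k *\<^sub>R e z)) * (f x \<bullet> grad (w z (Suc k)) x))"
          by (rule suminf_finite) (auto simp: w0[OF z])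
        finally show ?thesis .
      qed
      have "(\<Sum>z\<in>Z. (\<phi> (x + h n *\<^sub>R e z) - \<phi> x) *\<^sub>R grad (w z n) x) = 0"
        by (intro sum.neutral) (simp add: w0)
      then show ?thesis
        unfolding grad_\<tau>[OF \<phi> supp x] F_def
        by (simp add: \<psi>1[OF n] inner_diff_right inner_sum_right sum.distrib H1 H2)
    qed
    then show ?thesis
      by (intro tendsto_eventually) (auto simp: eventually_sequentially)
  qed
  have smooth_\<tau>: "smooth_fun (\<tau> \<phi> n)" for n
    using test_fun_\<tau>[OF \<phi>] by (simp add: test_fun_def)
  let ?M = "B + card Z * B + card Z * (B * C) + card Z * (B * C)"
  have "(\<lambda>n. \<integral>x. f x \<bullet> grad (\<tau> \<phi> n) x \<partial>lborel) \<longlonglongrightarrow> (\<integral>x. F x \<partial>lborel)"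
  proof (rule integral_dominated_convergence)
    show "integrable lborel (\<lambda>x. norm (f x) * ?M)" using f by simp
    show "AE x in lborel. (\<lambda>n. f x \<bullet> grad (\<tau> \<phi> n) x) \<longlonglongrightarrow> F x" using lim by simp
    show "AE x in lborel. norm (f x \<bullet> grad (\<tau> \<phi> n) x) \<le> norm (f x) * ?M" for n
    proof (rule AE_I2)
      fix x
      show "norm (f x \<bullet> grad (\<tau> \<phi> n) x) \<le> norm (f x) * ?M"
      proof (cases "x \<in> \<Omega>")
        case True
        have "norm (f x \<bullet> grad (\<tau> \<phi> n) x) \<le> norm (f x) * norm (grad (\<tau> \<phi> n) x)"
          by (simp add: Cauchy_Schwarz_ineq2)
        also have "\<dots> \<le> norm (f x) * ?M"
          by (intro mult_left_mono norm_grad_\<tau>_le \<phi> supp True B) auto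
        finally show ?thesis .
      qed (simp add: f0)
    qed
    show "(\<lambda>x. f x \<bullet> grad (\<tau> \<phi> n) x) \<in> borel_measurable lborel" for n
      using f mG[OF smooth_\<tau>] by simp
  qed (use sF in simp)
  moreover have "(\<integral>x. f x \<bullet> grad (\<tau> \<phi> n) x \<partial>lborel) = 0" for n
    by (rule div[OF test_fun_\<tau>[OF \<phi>]])
  ultimately show ?thesis
    unfolding eq by (simp add: LIMSEQ_const_iff)
qed

end

text \<open>Multiplying the Borel representative by the indicator makes it vanish at every point off
  \<Omega>, which the pointwise \<open>Ext_eq_on_dom\<close> needs.\<close>

lemma L1_representative:
  fixes u :: "'a::euclidean_space \<Rightarrow> 'a"
  assumes "open \<Omega>" "L1 \<Omega> u"
  shows "\<exists>f. integrable lborel f \<and> (\<forall>x. x \<notin> \<Omega> \<longrightarrow> f x = 0) \<and>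
    (AE x in lborel. f x = indicator \<Omega> x *\<^sub>R u x)"
proof -
  obtain g where g: "integrable lborel g" "AE x in lborel. g x = indicator \<Omega> x *\<^sub>R u x"
    using integrable_completion_representative[of lborel "\<lambda>x. indicator \<Omega> x *\<^sub>R u x"] assms
    unfolding L1_def set_integrable_def by blast
  have "integrable lborel (\<lambda>x. indicator \<Omega> x *\<^sub>R g x)"
    using assms(1) g(1) by (intro integrable_mult_indicator) auto
  moreover have "AE x in lborel. indicator \<Omega> x *\<^sub>R g x = indicator \<Omega> x *\<^sub>R u x"
    using g(2) by eventually_elim (auto simp: indicator_def)
  ultimately show ?thesis
    by (intro exI[of _ "\<lambda>x. indicator \<Omega> x *\<^sub>R g x"]) auto
qed

lemma set_integral_lebesgue_eq_lborel:
  fixes f :: "'a::euclidean_space \<Rightarrow> 'b::euclidean_space" and g :: "'a \<Rightarrow> 'b"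
  assumes g: "g \<in> borel_measurable borel"
    and f: "(\<lambda>x. indicator A x *\<^sub>R f x) \<in> borel_measurable lebesgue"
    and eq: "AE x in lborel. indicator A x *\<^sub>R f x = g x"
  shows "(LINT x:A|lebesgue. f x) = (\<integral>x. g x \<partial>lborel)"
proof -
  have "(LINT x:A|lebesgue. f x) = (\<integral>x. g x \<partial>lebesgue)"
    unfolding set_lebesgue_integral_def
    by (intro integral_cong_AE f measurable_completion AE_completion eq) (use g in simp)
  also have "\<dots> = (\<integral>x. g x \<partial>lborel)"
    by (rule integral_completion) (use g in simp)
  finally show ?thesis .
qed

theorem theorem2p1:
  fixes \<Omega> :: "'a::euclidean_space set"
  assumes "lipschitz_domain \<Omega>"
  shows "\<exists>\<Omega>' (E :: ('a \<Rightarrow> 'a) \<Rightarrow> ('a \<Rightarrow> 'a)) C.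
           open \<Omega>' \<and> compact (closure \<Omega>) \<and> closure \<Omega> \<subseteq> \<Omega>' \<and>
           (\<forall>u. L1 \<Omega> u \<longrightarrow> L1 \<Omega>' (E u)) \<and>
           (\<forall>u v a b. L1 \<Omega> u \<longrightarrow> L1 \<Omega> v \<longrightarrow>
              (AE x in lebesgue. x \<in> \<Omega>' \<longrightarrow>
                 E (\<lambda>y. a *\<^sub>R u y + b *\<^sub>R v y) x = a *\<^sub>R E u x + b *\<^sub>R E v x)) \<and>
           (\<forall>u. L1 \<Omega> u \<longrightarrow> L1_norm \<Omega>' (E u) \<le> C * L1_norm \<Omega> u) \<and>
           (\<forall>u. L1 \<Omega> u \<longrightarrow> (AE x in lebesgue. x \<in> \<Omega> \<longrightarrow> E u x = u x)) \<and>
           (\<forall>u. L1_div \<Omega> u \<longrightarrow> L1_div \<Omega>' (E u))"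
proof -
  obtain \<Omega>' Z e \<theta> \<psi> H X D where \<Omega>': "open \<Omega>'" "closure \<Omega> \<subseteq> \<Omega>'"
    and col: "collar \<Omega> \<Omega>' Z e \<theta> \<psi> H X D"
    using lipschitz_domain_collar[OF assms] by blast
  interpret collar \<Omega> \<Omega>' Z e \<theta> \<psi> H X D by (rule col)
  \<comment> \<open>The chosen representative need not depend linearly on \<open>u\<close>;
    linearity of \<open>E\<close> is therefore derived a.e., through
    \<open>Ext_cong_AE\<close>.\<close>
  define rep where "rep u = (SOME f. integrable lborel f \<and> (\<forall>x. x \<notin> \<Omega> \<longrightarrow> f x = 0) \<and>
    (AE x in lborel. f x = indicator \<Omega> x *\<^sub>R u x))" for u :: "'a \<Rightarrow> 'a"
  have rep: "integrable lborel (rep u)" "\<And>x. x \<notin> \<Omega> \<Longrightarrow> rep u x = 0"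
    "AE x in lborel. rep u x = indicator \<Omega> x *\<^sub>R u x" if "L1 \<Omega> u" for u
    using someI_ex[OF L1_representative[OF open_dom that], folded rep_def] by blast+
  define E where "E u = Ext (rep u)" for u
  have intE: "integrable lborel (E u)" if "L1 \<Omega> u" for u
    unfolding E_def by (rule integrable_Ext[OF rep(1)[OF that]])
  have mE: "E u \<in> borel_measurable borel" if "L1 \<Omega> u" for u
    using borel_measurable_integrable[OF intE[OF that]] by simp
  have int\<Omega>': "integrable lborel (\<lambda>x. indicator \<Omega>' x *\<^sub>R E u x)" if "L1 \<Omega> u" for u
    using \<Omega>'(1) intE[OF that] by (intro integrable_mult_indicator) auto
  have L1E: "L1 \<Omega>' (E u)" if "L1 \<Omega> u" for u
    unfolding L1_def set_integrable_def
    using int\<Omega>'[OF that] by (subst integrable_completion) auto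
  have linE: "AE x in lebesgue. x \<in> \<Omega>' \<longrightarrow>
      E (\<lambda>y. a *\<^sub>R u y + b *\<^sub>R v y) x = a *\<^sub>R E u x + b *\<^sub>R E v x"
    if u: "L1 \<Omega> u" and v: "L1 \<Omega> v" for u v a b
  proof -
    let ?s = "\<lambda>y. a *\<^sub>R u y + b *\<^sub>R v y"
    have s: "L1 \<Omega> ?s"
      using u v unfolding L1_def by (intro set_integral_add set_integrable_scaleR_right) auto
    have "AE x in lborel. rep ?s x = a *\<^sub>R rep u x + b *\<^sub>R rep v x"
      using rep(3)[OF s] rep(3)[OF u] rep(3)[OF v]
      by eventually_elim (simp add: algebra_simps)
    then have "AE x in lborel. E ?s x = Ext (\<lambda>x. a *\<^sub>R rep u x + b *\<^sub>R rep v x) x"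
      unfolding E_def using rep(1)[OF s] rep(1)[OF u] rep(1)[OF v] by (intro Ext_cong_AE) auto
    then have "AE x in lborel. x \<in> \<Omega>' \<longrightarrow> E ?s x = a *\<^sub>R E u x + b *\<^sub>R E v x"
      using Ext_linear_AE[OF rep(1)[OF u] rep(1)[OF v], of a b]
      by eventually_elim (simp add: E_def)
    then show ?thesis by (rule AE_completion)
  qed
  have normE: "L1_norm \<Omega>' (E u) \<le> (1 + card Z * (1 + C)) * L1_norm \<Omega> u" if u: "L1 \<Omega> u" for u
  proof -
    have "L1_norm \<Omega>' (E u) = (\<integral>x. norm (indicator \<Omega>' x *\<^sub>R E u x) \<partial>lborel)"
      unfolding L1_norm_def
      by (rule set_integral_lebesgue_eq_lborel)
         (use \<Omega>'(1) mE[OF u] in \<open>auto intro!: measurable_completion\<close>)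
    also have "\<dots> \<le> (\<integral>x. norm (E u x) \<partial>lborel)"
      by (intro integral_mono integrable_norm int\<Omega>' intE u) (auto simp: indicator_def)
    also have "\<dots> \<le> (1 + card Z * (1 + C)) * (\<integral>x. norm (rep u x) \<partial>lborel)"
      unfolding E_def by (rule integral_norm_Ext_le[OF rep(1)[OF u]])
    also have "(\<integral>x. norm (rep u x) \<partial>lborel) = L1_norm \<Omega> u"
      unfolding L1_norm_def
    proof (rule set_integral_lebesgue_eq_lborel[symmetric])
      show "(\<lambda>x. norm (rep u x)) \<in> borel_measurable borel"
        using borel_measurable_integrable[OF rep(1)[OF u]] by simp
      have "set_integrable lebesgue \<Omega> (\<lambda>x. norm (u x))"
        using u unfolding L1_def by (rule set_integrable_norm)
      then show "(\<lambda>x. indicator \<Omega> x *\<^sub>R norm (u x)) \<in> borel_measurable lebesgue"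
        unfolding set_integrable_def by auto
      show "AE x in lborel. indicator \<Omega> x *\<^sub>R norm (u x) = norm (rep u x)"
        using rep(3)[OF u] by eventually_elim simp
    qed
    finally show ?thesis .
  qed
  have extE: "AE x in lebesgue. x \<in> \<Omega> \<longrightarrow> E u x = u x" if u: "L1 \<Omega> u" for u
  proof -
    have "AE x in lborel. x \<in> \<Omega> \<longrightarrow> E u x = u x"
      using rep(3)[OF u] by eventually_elim (simp add: E_def Ext_eq_on_dom rep(2)[OF u])
    then show ?thesis by (rule AE_completion)
  qed
  have divE: "L1_div \<Omega>' (E u)" if u: "L1_div \<Omega> u" for u
    unfolding L1_div_def
  proof (intro conjI allI impI)
    have u1: "L1 \<Omega> u" using u by (simp add: L1_div_def)
    show "L1 \<Omega>' (E u)" by (rule L1E[OF u1])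
    have mgrad: "grad g \<in> borel_measurable borel" if "test_fun A g" for g :: "'a \<Rightarrow> real" and A
      using that by (intro borel_measurable_continuous_onI smooth_continuous_grad) (simp add: test_fun_def)
    have mrep: "rep u \<in> borel_measurable borel"
      using borel_measurable_integrable[OF rep(1)[OF u1]] by simp
    fix \<phi> assume \<phi>: "test_fun \<Omega>' \<phi>"
    then have s\<phi>: "smooth_fun \<phi>" by (simp add: test_fun_def)
    have div: "(\<integral>x. rep u x \<bullet> grad g x \<partial>lborel) = 0" if g: "test_fun \<Omega> g" for g
    proof -
      have sg: "smooth_fun g" using g by (simp add: test_fun_def)
      note [measurable] = mrep mgrad[OF g]
      have mu: "(\<lambda>x. indicator \<Omega> x *\<^sub>R u x) \<in> borel_measurable lebesgue"
        using u1 unfolding L1_def set_integrable_def by auto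
      have "(\<lambda>x. (indicator \<Omega> x *\<^sub>R u x) \<bullet> grad g x) \<in> borel_measurable lebesgue"
        by (intro borel_measurable_inner mu measurable_completion) simp
      then have m: "(\<lambda>x. indicator \<Omega> x *\<^sub>R (u x \<bullet> grad g x)) \<in> borel_measurable lebesgue"
        by simp
      have "(LINT x:\<Omega>|lebesgue. u x \<bullet> grad g x) = (\<integral>x. rep u x \<bullet> grad g x \<partial>lborel)"
      proof (rule set_integral_lebesgue_eq_lborel[OF _ m])
        show "AE x in lborel. indicator \<Omega> x *\<^sub>R (u x \<bullet> grad g x) = rep u x \<bullet> grad g x"
          using rep(3)[OF u1] by eventually_elim simp
      qed measurable
      moreover have "(LINT x:\<Omega>|lebesgue. u x \<bullet> grad g x) = 0"
      proof -
        have "u x \<bullet> grad g x = frechet_derivative g (at x) (u x)" for x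
          by (simp add: smooth_inner_grad[OF sg] inner_commute)
        then show ?thesis using u g by (simp add: L1_div_def)
      qed
      ultimately show ?thesis by simp
    qed
    obtain S where S: "compact S" "S \<subseteq> \<Omega>'" "\<And>x. x \<notin> S \<Longrightarrow> \<phi> x = 0"
      using \<phi> unfolding test_fun_def by blast
    \<comment> \<open>Hence the integral over \<open>\<Omega>'\<close> equals the one over the whole
      space, to which \<open>Ext_divergence_free\<close> applies.\<close>
    have g0: "grad \<phi> x = 0" if "x \<notin> \<Omega>'" for x
      using smooth_compact_support_grad_bounded[OF s\<phi> S(1,3)] S(2) that by blast
    note [measurable] = mE[OF u1] mgrad[OF \<phi>]
    have "(LINT x:\<Omega>'|lebesgue. frechet_derivative \<phi> (at x) (E u x)) = (LINT x:\<Omega>'|lebesgue. E u x \<bullet> grad \<phi> x)"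
      by (simp add: smooth_inner_grad[OF s\<phi>] inner_commute)
    also have "\<dots> = (\<integral>x. E u x \<bullet> grad \<phi> x \<partial>lborel)"
    proof (rule set_integral_lebesgue_eq_lborel)
      have eq: "indicator \<Omega>' x *\<^sub>R (E u x \<bullet> grad \<phi> x) = E u x \<bullet> grad \<phi> x" for x
        using g0[of x] by (auto simp: indicator_def)
      show "(\<lambda>x. indicator \<Omega>' x *\<^sub>R (E u x \<bullet> grad \<phi> x)) \<in> borel_measurable lebesgue"
        unfolding eq by (intro measurable_completion) simp
      show "AE x in lborel. indicator \<Omega>' x *\<^sub>R (E u x \<bullet> grad \<phi> x) = E u x \<bullet> grad \<phi> x"
        unfolding eq by simp
    qed measurable
    also have "\<dots> = 0"
      unfolding E_def by (rule Ext_divergence_free[OF rep(1)[OF u1] rep(2)[OF u1] div \<phi>])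
    finally show "(LINT x:\<Omega>'|lebesgue. frechet_derivative \<phi> (at x) (E u x)) = 0" .
  qed
  have "compact (closure \<Omega>)"
    using assms by (simp add: lipschitz_domain_def compact_closure)
  with \<Omega>' L1E linE normE extE divE show ?thesis
    by (intro exI[of _ \<Omega>'] exI[of _ E] exI[of _ "1 + card Z * (1 + C)"]) blast
qed

end
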